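(* Let $\mathcal H$ be a nonzero real Hilbert space, let $L>0$, and let $f:\mathcal H\to\mathbb R$ be convex, differentiable and $L$-smooth. Let $x_\star\in\mathcal H$ be a minimizer of $f$. Fix an integer $N\ge 1$ and $R\ge 0$, and let $x_0\in\mathcal H$ satisfy $\|x_0-x_\star\|\le R$. Let $\theta_0=1$ and $\theta_{k+1}=\frac{1+\sqrt{1+4\theta_k^2}}{2}$ for $k\ge 0$. Starting from $x_0=y_0=z_0$, define for $0\le k<N$ $$y_{k+1}=x_k-\tfrac1L\nabla f(x_k),\qquad z_{k+1}=z_k-\tfrac{\theta_k}{L}\nabla f(x_k),\qquad x_{k+1}=\Bigl(1-\tfrac1{\theta_{k+1}}\Bigr)y_{k+1}+\tfrac1{\theta_{k+1}}z_{k+1}.$$ Then $$f(x_N)-f(x_\star)\le \frac{LR^2\,\theta_{N}^2}{2\left(2\sum_{j=0}^{N}\theta_j^3-\theta_{N}^2\right)}.$$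
   Context: $L$-smooth means $\|\nabla f(x)-\nabla f(y)\|\le L\|x-y\|$ for all $x,y\in\mathcal H$. The iteration is Nesterov's fast gradient method (FGM). *)

theory Defs
  imports "HOL-Analysis.Analysis"
begin

text \<open>
  The gradient of \<open>f\<close> at \<open>x\<close> is the vector representing the Frechet derivative:
  \<open>GDERIV f x :> D\<close> unfolds to \<open>(f has_derivative (\<lambda>h. inner h D)) (at x)\<close>.
  It exists at every point of differentiability by the Riesz representation theorem;
  see \<open>GDERIV_gradient\<close> below.
\<close>

definition gradient :: "('a::real_inner \<Rightarrow> real) \<Rightarrow> 'a \<Rightarrow> 'a" where
  "gradient f x = (THE D. GDERIV f x :> D)"

definition L_smooth :: "real \<Rightarrow> ('a::real_inner \<Rightarrow> real) \<Rightarrow> bool" where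
  "L_smooth L f \<longleftrightarrow>
     (\<forall>x y. norm (gradient f x - gradient f y) \<le> L * norm (x - y))"

primrec \<theta> :: "nat \<Rightarrow> real" where
  "\<theta> 0 = 1"
| "\<theta> (Suc k) = (1 + sqrt (1 + 4 * (\<theta> k)\<^sup>2)) / 2"

definition FGM_iterates ::
  "nat \<Rightarrow> real \<Rightarrow> ('a::real_inner \<Rightarrow> real) \<Rightarrow> (nat \<Rightarrow> 'a) \<Rightarrow> (nat \<Rightarrow> 'a) \<Rightarrow> (nat \<Rightarrow> 'a) \<Rightarrow> bool" where
  "FGM_iterates N L f x y z \<longleftrightarrow>
     y 0 = x 0 \<and> z 0 = x 0 \<and>
     (\<forall>k<N.
        y (Suc k) = x k - (1 / L) *\<^sub>R gradient f (x k) \<and>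
        z (Suc k) = z k - (\<theta> k / L) *\<^sub>R gradient f (x k) \<and>
        x (Suc k) = (1 - 1 / \<theta> (Suc k)) *\<^sub>R y (Suc k) + (1 / \<theta> (Suc k)) *\<^sub>R z (Suc k))"

lemma riesz_representation:
  fixes \<phi> :: "'a::{real_inner, complete_space} \<Rightarrow> real"
  assumes "bounded_linear \<phi>"
  shows "\<exists>u. \<forall>h. \<phi> h = inner h u"
proof -
  interpret bounded_linear \<phi> by fact
  define J where "J v = (norm v)\<^sup>2 / 2 - \<phi> v" for v
  obtain B where B: "\<And>v. norm (\<phi> v) \<le> norm v * B"
    using bounded by blast
  have lower: "- (B\<^sup>2 / 2) \<le> J v" for v
  proof -
    have "\<phi> v \<le> norm v * B" using B[of v] by simp
    moreover have "0 \<le> (norm v - B)\<^sup>2" by simp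
    ultimately show ?thesis unfolding J_def power2_diff by (simp add: algebra_simps)
  qed
  define m where "m = (INF v. J v)"
  have bdd: "bdd_below (range J)" using lower by (auto intro!: bdd_belowI2)
  have m: "m \<le> J v" for v unfolding m_def by (rule cINF_lower[OF bdd]) simp
  have "\<exists>v. J v < m + inverse (real (Suc n))" for n
  proof -
    have "(INF v. J v) < m + inverse (real (Suc n))" by (simp add: m_def)
    then show ?thesis using cINF_less_iff[OF _ bdd] by auto
  qed
  then obtain w where w: "\<And>n. J (w n) < m + inverse (real (Suc n))" by metis
  have mid: "(norm (a - b))\<^sup>2 / 4 = J a + J b - 2 * J ((1/2) *\<^sub>R (a + b))" for a b
    unfolding J_def power2_norm_eq_inner
    by (simp add: scaleR add inner_add inner_diff inner_commute[of b a]) argo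
  have close: "(norm (w i - w j))\<^sup>2 < 4 * (inverse (real (Suc i)) + inverse (real (Suc j)))" for i j
    using mid[of "w i" "w j"] w[of i] w[of j] m[of "(1/2) *\<^sub>R (w i + w j)"] by argo
  have "Cauchy w"
  proof (rule metric_CauchyI)
    fix e :: real assume e: "0 < e"
    obtain n where n: "inverse (real (Suc n)) < e\<^sup>2 / 8"
      using reals_Archimedean[of "e\<^sup>2 / 8"] e by auto
    have "dist (w i) (w j) < e" if "n \<le> i" "n \<le> j" for i j
    proof -
      have "inverse (real (Suc i)) \<le> inverse (real (Suc n))"
        "inverse (real (Suc j)) \<le> inverse (real (Suc n))"
        using that by (auto intro!: le_imp_inverse_le)
      then have "(norm (w i - w j))\<^sup>2 < e\<^sup>2" using close[of i j] n by argo
      then show ?thesis using e by (simp add: dist_norm power2_less_imp_less)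
    qed
    then show "\<exists>M. \<forall>i\<ge>M. \<forall>j\<ge>M. dist (w i) (w j) < e" by blast
  qed
  then obtain u where u: "w \<longlonglongrightarrow> u" using Cauchy_convergent convergent_def by blast
  have "(\<lambda>n. J (w n)) \<longlonglongrightarrow> J u"
    unfolding J_def by (intro tendsto_intros u tendsto) simp
  moreover have "(\<lambda>n. m + inverse (real (Suc n))) \<longlonglongrightarrow> m + 0"
    by (intro tendsto_intros LIMSEQ_inverse_real_of_nat)
  ultimately have "J u \<le> m"
    using w by (intro LIMSEQ_le[of "\<lambda>n. J (w n)" "J u" _ m]) (auto intro: less_imp_le)
  then have min: "J u \<le> J v" for v using m[of v] by simp
  have "\<phi> h = inner h u" for h
  proof (rule ccontr)
    define d where "d = inner h u - \<phi> h"
    assume "\<phi> h \<noteq> inner h u"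
    then have d: "d \<noteq> 0" by (simp add: d_def)
    define q where "q = (norm h)\<^sup>2 + 1"
    have q: "q > 0" unfolding q_def by (simp add: add_nonneg_pos)
    have "J (u + t *\<^sub>R h) = J u + t * d + t\<^sup>2 * (norm h)\<^sup>2 / 2" for t
      unfolding J_def d_def power2_norm_eq_inner
      by (simp add: scaleR add inner_add inner_commute[of h u] power2_eq_square algebra_simps)
    then have "0 \<le> t * d + t\<^sup>2 * (norm h)\<^sup>2 / 2" for t
      using min[of "u + t *\<^sub>R h"] by simp
    moreover have "t\<^sup>2 * (norm h)\<^sup>2 \<le> t\<^sup>2 * q" for t
      by (simp add: q_def mult_left_mono)
    ultimately have *: "0 \<le> t * d + t\<^sup>2 * q / 2" for t
      by (meson add_left_mono divide_right_mono order_trans zero_le_numeral)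
    have "(- d / q) * d + (- d / q)\<^sup>2 * q / 2 = - (d\<^sup>2 / (2 * q))"
      using q by (simp add: power2_eq_square field_simps)
    moreover have "d\<^sup>2 / (2 * q) > 0" using d q by simp
    ultimately show False using *[of "- d / q"] by linarith
  qed
  then show ?thesis by blast
qed

lemma GDERIV_gradient:
  fixes f :: "'a::{real_inner, complete_space} \<Rightarrow> real"
  assumes "f differentiable (at x)"
  shows "GDERIV f x :> gradient f x"
proof -
  obtain \<phi> where \<phi>: "(f has_derivative \<phi>) (at x)"
    using assms by (auto simp: differentiable_def)
  obtain u where u: "\<And>h. \<phi> h = inner h u"
    using riesz_representation[OF has_derivative_bounded_linear[OF \<phi>]] by blast
  have "\<phi> = (\<lambda>h. inner h u)" using u by blast
  with \<phi> have "GDERIV f x :> u" by (simp add: gderiv_def)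
  moreover have "D = u" if "GDERIV f x :> D" for D
  proof -
    have "(\<lambda>h. inner h D) = \<phi>"
      using that \<phi> unfolding gderiv_def by (rule has_derivative_unique)
    then have "inner (D - u) D = inner (D - u) u" using u by metis
    then have "inner (D - u) (D - u) = 0" by (simp add: inner_diff_right)
    then show ?thesis by simp
  qed
  ultimately show ?thesis unfolding gradient_def by (rule theI)
qed

end

theory Submission
  imports Defs
begin

text \<open>
  Divide \<open>f\<close> and its gradients by \<open>L\<close>, so that \<open>L = 1\<close>, and write \<open>g\<^sub>k\<close> for the gradient at \<open>x\<^sub>k\<close>. The proof
  is a certificate built from two families of interpolation inequalities: those between consecutive
  iterates \<open>x\<^sub>k\<close> and \<open>x\<^sub>k\<^sub>+\<^sub>1\<close>, and those between the minimizer and each \<open>x\<^sub>k\<close>. They are added with the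
  multipliers \<open>chain\<close> and \<open>star\<close>; as \<open>star\<close> is the increment of \<open>chain\<close>, the function values
  telescope to \<open>f x\<^sub>N - f x\<^sub>*\<close> (\<open>weighted_interpolation_sum\<close>). Completing the square in
  \<open>x\<^sub>0 - x\<^sub>*\<close> produces the term \<open>(norm (x\<^sub>0 - x\<^sub>*))\<^sup>2 / (2 * rate N)\<close>, which is the claimed bound, and leaves a
  quadratic form in \<open>g\<^sub>0, \<dots>, g\<^sub>N\<close> that has to be nonnegative.

  The bound is attained by a Huber function along whose iterates all gradients coincide. So the
  quadratic form must vanish together with its derivative at \<open>g\<^sub>0 = \<dots> = g\<^sub>N\<close>, and this determines the
  multipliers of the two families uniquely. It also means that the form is a weighted sum of the
  squared distances \<open>(norm (g\<^sub>i - g\<^sub>k))\<^sup>2\<close> with the weights \<open>coupling\<close>, by \<open>coupling_row_sum\<close>.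

  The weights between two gradients before the last one are nonnegative, but for large \<open>N\<close> some
  weights that involve \<open>g\<^sub>N\<close> are negative. Eliminating \<open>g\<^sub>N\<close> (\<open>Laplacian_nonneg_by_elimination\<close>)
  repairs this: the Schur complement is again a weighted sum of squared distances, and its weights
  are nonnegative by \<open>coupling_schur_nonneg\<close>. The estimates behind this last fact rest on
  \<open>\<theta>_mean k\<close> being \<open>2/3 * \<theta> k\<close> up to a constant between \<open>1/4\<close> and \<open>1/3\<close>, which reduces each of them to a
  polynomial inequality in \<open>\<theta> k\<close> and \<open>\<theta> N\<close>.
\<close>

section \<open>Interpolation inequalities of smooth convex functions\<close>

lemma GDERIV_along_line:
  fixes f :: "'a::real_inner \<Rightarrow> real"
  assumes "\<And>u. GDERIV f u :> g u"
  shows "((\<lambda>t. f (u + t *\<^sub>R v)) has_real_derivative inner (g (u + t *\<^sub>R v)) v) (at t)"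
proof -
  have "(f has_derivative (\<lambda>h. inner h (g (u + t *\<^sub>R v)))) (at (u + t *\<^sub>R v))"
    using assms[of "u + t *\<^sub>R v"] by (simp add: gderiv_def)
  moreover have "((\<lambda>t. u + t *\<^sub>R v) has_derivative (\<lambda>h. h *\<^sub>R v)) (at t)"
    by (auto intro!: derivative_eq_intros)
  ultimately have "((\<lambda>t. f (u + t *\<^sub>R v)) has_derivative (\<lambda>h. inner (h *\<^sub>R v) (g (u + t *\<^sub>R v)))) (at t)"
    by (rule has_derivative_compose[rotated])
  then show ?thesis
    by (simp add: has_field_derivative_def inner_commute mult.commute[of _ "inner _ _"] mult_commute_abs)
qed

text \<open>
  Along the segment from \<open>u\<close> to \<open>u + v\<close> the difference of the two sides is monotone, since its
  derivative is controlled by the Lipschitz condition.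
\<close>

lemma Lipschitz_gradient_upper_bound:
  fixes f :: "'a::real_inner \<Rightarrow> real"
  assumes grad: "\<And>u. GDERIV f u :> g u"
    and lip: "\<And>u w. norm (g u - g w) \<le> L * norm (u - w)"
  shows "f (u + v) \<le> f u + inner (g u) v + L / 2 * (norm v)\<^sup>2"
proof -
  define \<phi> where "\<phi> t = f (u + t *\<^sub>R v) - (t * inner (g u) v + L * t\<^sup>2 / 2 * (norm v)\<^sup>2)" for t
  have "\<phi> 1 \<le> \<phi> 0"
  proof (rule DERIV_nonpos_imp_nonincreasing[of 0 1 \<phi>])
    fix t :: real assume t: "0 \<le> t" "t \<le> 1"
    define D where "D = inner (g (u + t *\<^sub>R v)) v - (inner (g u) v + L * t * (norm v)\<^sup>2)"
    have "(\<phi> has_real_derivative D) (at t)"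
      unfolding \<phi>_def D_def
      by (rule derivative_eq_intros GDERIV_along_line[OF grad] refl | simp)+
    moreover have "D \<le> 0"
    proof -
      have "inner (g (u + t *\<^sub>R v) - g u) v \<le> norm (g (u + t *\<^sub>R v) - g u) * norm v"
        by (rule norm_cauchy_schwarz)
      also have "\<dots> \<le> (L * norm (t *\<^sub>R v)) * norm v"
        using lip[of "u + t *\<^sub>R v" u] by (intro mult_right_mono) auto
      also have "\<dots> = L * t * (norm v)\<^sup>2"
        using t by (simp add: power2_eq_square)
      finally show ?thesis by (simp add: D_def inner_diff_left)
    qed
    ultimately show "\<exists>y. DERIV \<phi> t :> y \<and> y \<le> 0" by blast
  qed simp
  then show ?thesis by (simp add: \<phi>_def)
qed

lemma convex_above_gradient_tangent:
  fixes f :: "'a::real_inner \<Rightarrow> real"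
  assumes grad: "\<And>u. GDERIV f u :> g u" and conv: "convex_on UNIV f"
  shows "f u + inner (g u) (w - u) \<le> f w"
proof -
  define \<phi> where "\<phi> t = f (u + t *\<^sub>R (w - u))" for t
  have "convex_on UNIV \<phi>"
  proof (rule convex_onI)
    fix t a b :: real assume "0 < t" "t < 1"
    have "u + ((1 - t) *\<^sub>R a + t *\<^sub>R b) *\<^sub>R (w - u)
        = (1 - t) *\<^sub>R (u + a *\<^sub>R (w - u)) + t *\<^sub>R (u + b *\<^sub>R (w - u))"
      by (simp add: algebra_simps)
    then show "\<phi> ((1 - t) *\<^sub>R a + t *\<^sub>R b) \<le> (1 - t) * \<phi> a + t * \<phi> b"
      unfolding \<phi>_def using convex_onD[OF conv, of t] \<open>0 < t\<close> \<open>t < 1\<close> by simp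
  qed simp
  moreover have "(\<phi> has_real_derivative inner (g u) (w - u)) (at 0)"
    unfolding \<phi>_def using GDERIV_along_line[OF grad, of u "w - u" 0] by simp
  ultimately have "\<phi> 1 - \<phi> 0 \<ge> inner (g u) (w - u) * (1 - 0)"
    by (intro convex_on_imp_above_tangent[of UNIV]) auto
  then show ?thesis by (simp add: \<phi>_def)
qed

text \<open>
  Compare \<open>f\<close> with its tangent at \<open>u\<close>: the tangent bounds \<open>f\<close> from below at the point that one gradient
  step of \<open>f\<close> minus the tangent reaches from \<open>w\<close>, and this step decreases the difference by at least
  the squared norm on the right.
\<close>

lemma smooth_convex_interpolation:
  fixes f :: "'a::real_inner \<Rightarrow> real"
  assumes grad: "\<And>u. GDERIV f u :> g u" and conv: "convex_on UNIV f" and "L > 0"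
    and lip: "\<And>u w. norm (g u - g w) \<le> L * norm (u - w)"
  shows "f u + inner (g u) (w - u) + (norm (g w - g u))\<^sup>2 / (2 * L) \<le> f w"
proof -
  define d where "d = g w - g u"
  define v where "v = - (1 / L) *\<^sub>R d"
  have "f u + inner (g u) (w + v - u) \<le> f (w + v)"
    by (rule convex_above_gradient_tangent[OF grad conv])
  also have "\<dots> \<le> f w + inner (g w) v + L / 2 * (norm v)\<^sup>2"
    by (rule Lipschitz_gradient_upper_bound[OF grad lip])
  finally have "f u + inner (g u) (w - u) \<le> f w + inner (g w - g u) v + L / 2 * (norm v)\<^sup>2"
    by (simp add: inner_diff_left inner_diff_right inner_add_right)
  also have "inner (g w - g u) v = - ((norm d)\<^sup>2 / L)"
    by (simp add: v_def power2_norm_eq_inner flip: d_def)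
  also have "L / 2 * (norm v)\<^sup>2 = (norm d)\<^sup>2 / (2 * L)"
    using \<open>L > 0\<close> by (simp add: v_def power2_eq_square field_simps)
  finally show ?thesis using \<open>L > 0\<close> by (simp add: field_simps flip: d_def)
qed

lemma gradient_zero_at_minimizer:
  fixes f :: "'a::real_inner \<Rightarrow> real"
  assumes grad: "\<And>u. GDERIV f u :> g u" and min: "\<And>u. f w \<le> f u"
  shows "g w = 0"
proof -
  have "(\<lambda>h. inner h (g w)) = (\<lambda>h. 0)"
    using grad[of w] min unfolding gderiv_def
    by (intro differential_zero_maxmin[of w UNIV f]) auto
  then have "inner (g w) (g w) = 0" by meson
  then show ?thesis by simp
qed

section \<open>Growth of the momentum parameters\<close>

text \<open>
  The mean of \<open>\<theta> 0, \<dots>, \<theta> k\<close> weighted by these numbers themselves: the sum of their squares divided by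
  their sum, which is \<open>(\<theta> k)\<^sup>2\<close>. The recursive form makes the bounds below provable by induction.
\<close>

primrec \<theta>_mean :: "nat \<Rightarrow> real" where
  "\<theta>_mean 0 = 1"
| "\<theta>_mean (Suc k) = 1 + \<theta>_mean k * (1 - 1 / \<theta> (Suc k))"

lemma \<theta>_square_Suc: "(\<theta> (Suc k))\<^sup>2 = \<theta> (Suc k) + (\<theta> k)\<^sup>2"
proof -
  have "(sqrt (1 + 4 * (\<theta> k)\<^sup>2))\<^sup>2 = 1 + 4 * (\<theta> k)\<^sup>2" by (simp add: add_nonneg_nonneg)
  then show ?thesis by (simp add: field_simps power2_eq_square)
qed

declare \<theta>.simps(2) [simp del]

lemma \<theta>_Suc_ge: "\<theta> (Suc k) \<ge> \<theta> k + 1 / 2"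
proof -
  have "\<theta> k * 2 \<le> sqrt (1 + 4 * (\<theta> k)\<^sup>2)"
    by (rule real_le_rsqrt) (simp add: power_mult_distrib)
  then show ?thesis by (simp add: \<theta>.simps(2))
qed

lemma \<theta>_mono: "i \<le> j \<Longrightarrow> \<theta> i + (real j - real i) / 2 \<le> \<theta> j"
proof (induction j rule: dec_induct)
  case (step n) then show ?case using \<theta>_Suc_ge[of n] by (simp add: field_simps)
qed simp

lemma \<theta>_ge_1: "\<theta> k \<ge> 1"
  using \<theta>_mono[of 0 k] by simp

lemma \<theta>_pos [simp]: "\<theta> k > 0" "\<theta> k \<noteq> 0"
  using \<theta>_ge_1[of k] by auto

lemma sum_\<theta>: "(\<Sum>i<k. \<theta> i) = (\<theta> k)\<^sup>2 - \<theta> k"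
proof (induction k)
  case (Suc k) then show ?case using \<theta>_square_Suc[of k] by simp
qed simp

lemma \<theta>_mean_Suc: "\<theta>_mean (Suc k) * (\<theta> (Suc k))\<^sup>2 = \<theta>_mean k * (\<theta> k)\<^sup>2 + (\<theta> (Suc k))\<^sup>2"
proof -
  define h where "h = \<theta> (Suc k)"
  have "(1 + \<theta>_mean k * (1 - 1 / h)) * h\<^sup>2 = h\<^sup>2 + \<theta>_mean k * (h\<^sup>2 - h)"
    by (simp add: h_def field_simps power2_eq_square)
  also have "h\<^sup>2 - h = (\<theta> k)\<^sup>2" using \<theta>_square_Suc[of k] by (simp add: h_def)
  finally show ?thesis by (simp add: h_def)
qed

lemma sum_\<theta>_square: "(\<Sum>i\<le>k. (\<theta> i)\<^sup>2) = \<theta>_mean k * (\<theta> k)\<^sup>2"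
  by (induction k) (simp_all add: \<theta>_mean_Suc del: \<theta>_mean.simps(2))

text \<open>
  With \<open>h = \<theta> (k + 1)\<close> one has \<open>(\<theta> k)\<^sup>2 = h\<^sup>2 - h\<close>, hence \<open>h^4 - (\<theta> k)^4 = 2 * h^3 - h\<^sup>2\<close>, so that the fourth
  powers telescope.
\<close>

lemma sum_\<theta>_cube: "2 * (\<Sum>i\<le>k. (\<theta> i)^3) = (\<theta> k)^4 + \<theta>_mean k * (\<theta> k)\<^sup>2"
proof (induction k)
  case (Suc k)
  define h a where "h = \<theta> (Suc k)" and "a = (\<theta> k)\<^sup>2"
  have a: "a = h\<^sup>2 - h" using \<theta>_square_Suc[of k] by (simp add: h_def a_def)
  have a2: "(\<theta> k)^4 = a\<^sup>2" by (simp add: a_def power2_eq_square power4_eq_xxxx)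
  have "2 * (\<Sum>i\<le>Suc k. (\<theta> i)^3) = a\<^sup>2 + \<theta>_mean k * a + 2 * h^3"
    using Suc unfolding a2 by (simp add: h_def a_def distrib_left)
  also have "\<dots> = (a\<^sup>2 + 2 * h^3 - h\<^sup>2) + \<theta>_mean (Suc k) * h\<^sup>2"
    using \<theta>_mean_Suc[of k] by (simp add: h_def a_def del: \<theta>_mean.simps(2))
  also have "a\<^sup>2 + 2 * h^3 - h\<^sup>2 = h^4" unfolding a by (simp add: algebra_simps power2_eq_square power3_eq_cube power4_eq_xxxx)
  finally show ?case by (simp add: h_def del: \<theta>_mean.simps(2))
qed simp

lemma \<theta>_mean_le: "\<theta>_mean k \<le> 2/3 * \<theta> k + 1/3"
proof (induction k)
  case (Suc k)
  define h where "h = \<theta> (Suc k)"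
  have h: "h \<ge> 1" using \<theta>_ge_1 by (simp add: h_def)
  have "\<theta>_mean k \<le> 2/3 * h" using Suc \<theta>_Suc_ge[of k] by (simp add: h_def)
  then have "\<theta>_mean k * (1 - 1 / h) \<le> 2/3 * h * (1 - 1 / h)"
    using h by (intro mult_right_mono) auto
  also have "\<dots> = 2/3 * h - 2/3" using h by (simp add: field_simps)
  finally show ?case by (simp add: h_def)
qed simp

text \<open>
  In terms of \<open>h = \<theta> (k + 1)\<close> one has \<open>\<theta> k = h * sqrt (1 - 1 / h)\<close>, and the induction step is the
  inequality \<open>(1 - y) powr (3/2) \<ge> 1 - 3/2 * y + 3/8 * y\<^sup>2\<close> at \<open>y = 1 / h\<close>, squared. The constant \<open>1/4\<close> is the
  limit of \<open>\<theta>_mean k - 2/3 * \<theta> k\<close>.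
\<close>

lemma \<theta>_mean_ge: "2/3 * \<theta> k + 1/4 \<le> \<theta>_mean k"
proof (induction k)
  case (Suc k)
  define h s where "h = \<theta> (Suc k)" and "s = \<theta> k"
  have s: "s \<ge> 1" and hs: "h \<ge> s + 1/2" using \<theta>_ge_1 \<theta>_Suc_ge[of k] by (simp_all add: h_def s_def)
  have h: "h \<ge> 3/2" using s hs by simp
  have sq: "s\<^sup>2 = h\<^sup>2 - h" using \<theta>_square_Suc[of k] by (simp add: h_def s_def)
  have "h\<^sup>2 - 3/2 * h + 3/8 \<le> s * (h - 1)"
  proof (rule power2_le_imp_le)
    have "(s * (h - 1))\<^sup>2 - (h\<^sup>2 - 3/2 * h + 3/8)\<^sup>2 = h / 8 - 9/64"
      unfolding power_mult_distrib sq by (simp add: power2_eq_square algebra_simps)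
    then show "(h\<^sup>2 - 3/2 * h + 3/8)\<^sup>2 \<le> (s * (h - 1))\<^sup>2" using h by simp
  qed (use s h in simp)
  then have "2/3 * h + 1/4 \<le> 1 + (2/3 * s + 1/4) * (1 - 1 / h)"
    using h by (simp add: field_simps power2_eq_square)
  also have "\<dots> \<le> 1 + \<theta>_mean k * (1 - 1 / h)"
    using Suc h by (intro add_left_mono mult_right_mono) (auto simp: s_def)
  finally show ?case by (simp add: h_def)
qed simp

declare \<theta>_mean.simps(2) [simp del]

section \<open>Weighted sums of squared distances\<close>

lemma norm_square_diff:
  fixes a b :: "'a::real_inner"
  shows "(norm (a - b))\<^sup>2 = (norm a)\<^sup>2 + (norm b)\<^sup>2 - 2 * inner a b"
  by (simp add: power2_norm_eq_inner inner_diff inner_commute[of b a])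

text \<open>
  Conversely, a quadratic form in the \<open>v k\<close> whose matrix has vanishing row sums is a weighted sum of
  squared distances; this is how the identity is used.
\<close>

lemma sum_weighted_distances:
  fixes v :: "nat \<Rightarrow> 'a::real_inner"
  shows "(\<Sum>k<n. \<Sum>i<k. w i k * (norm (v i - v k))\<^sup>2)
    = (\<Sum>k<n. ((\<Sum>i<k. w i k) + (\<Sum>j=Suc k..<n. w k j)) * (norm (v k))\<^sup>2)
      - 2 * (\<Sum>k<n. \<Sum>i<k. w i k * inner (v i) (v k))"
proof (induction n)
  case (Suc n)
  have "(\<Sum>k<n. ((\<Sum>i<k. w i k) + (\<Sum>j=Suc k..<Suc n. w k j)) * (norm (v k))\<^sup>2)
      = (\<Sum>k<n. ((\<Sum>i<k. w i k) + (\<Sum>j=Suc k..<n. w k j)) * (norm (v k))\<^sup>2 + w k n * (norm (v k))\<^sup>2)"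
    by (intro sum.cong) (auto simp: algebra_simps)
  moreover have "(\<Sum>i<n. w i n * (norm (v i - v n))\<^sup>2)
      = (\<Sum>i<n. w i n * (norm (v i))\<^sup>2) + (\<Sum>i<n. w i n) * (norm (v n))\<^sup>2
        - 2 * (\<Sum>i<n. w i n * inner (v i) (v n))"
    by (simp add: norm_square_diff algebra_simps sum.distrib sum_subtractf sum_distrib_left
        sum_distrib_right)
  ultimately show ?case using Suc by (simp add: sum.distrib algebra_simps)
qed simp

lemma norm_square_linear_combination:
  fixes v :: "nat \<Rightarrow> 'a::real_inner"
  shows "(norm (\<Sum>k<n. a k *\<^sub>R v k))\<^sup>2
    = (\<Sum>k<n. (a k)\<^sup>2 * (norm (v k))\<^sup>2) + 2 * (\<Sum>k<n. \<Sum>i<k. a i * a k * inner (v i) (v k))"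
proof (induction n)
  case (Suc n)
  have "inner (\<Sum>k<n. a k *\<^sub>R v k) (a n *\<^sub>R v n) = (\<Sum>i<n. a i * a n * inner (v i) (v n))"
    by (simp add: inner_sum_left sum_distrib_left mult_ac)
  then show ?case using Suc norm_square_diff[of "\<Sum>k<n. a k *\<^sub>R v k" "- (a n *\<^sub>R v n)"]
    by (simp add: power_mult_distrib distrib_left)
qed simp

lemma Lagrange_identity_weighted:
  fixes v :: "nat \<Rightarrow> 'a::real_inner"
  shows "(\<Sum>i<n. r i) * (\<Sum>i<n. r i * (norm (v i))\<^sup>2)
    = (norm (\<Sum>i<n. r i *\<^sub>R v i))\<^sup>2 + (\<Sum>k<n. \<Sum>i<k. r i * r k * (norm (v i - v k))\<^sup>2)"
proof (induction n)
  case (Suc n)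
  have "(\<Sum>i<n. r i * r n * (norm (v i - v n))\<^sup>2)
      = r n * (\<Sum>i<n. r i * (norm (v i))\<^sup>2) + r n * (\<Sum>i<n. r i) * (norm (v n))\<^sup>2
        - 2 * r n * (\<Sum>i<n. r i * inner (v i) (v n))"
  proof -
    have "r i * r n * (norm (v i - v n))\<^sup>2 = r n * (r i * (norm (v i))\<^sup>2)
        + r i * (r n * (norm (v n))\<^sup>2) - (2 * r n) * (r i * inner (v i) (v n))" for i
      by (simp add: norm_square_diff algebra_simps)
    then show ?thesis
      by (simp add: sum.distrib sum_subtractf flip: sum_distrib_left sum_distrib_right)
  qed
  moreover have "(norm ((\<Sum>i<n. r i *\<^sub>R v i) + r n *\<^sub>R v n))\<^sup>2
      = (norm (\<Sum>i<n. r i *\<^sub>R v i))\<^sup>2 + (r n)\<^sup>2 * (norm (v n))\<^sup>2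
        + 2 * r n * (\<Sum>i<n. r i * inner (v i) (v n))"
  proof -
    have "inner (\<Sum>i<n. r i *\<^sub>R v i) (v n) = (\<Sum>i<n. r i * inner (v i) (v n))"
      by (simp add: inner_sum_left)
    then show ?thesis
      by (simp add: norm_square_diff[of _ "- r n *\<^sub>R v n", simplified] power_mult_distrib)
  qed
  ultimately show ?case using Suc by (simp add: algebra_simps power2_eq_square)
qed simp

text \<open>
  Some weights \<open>w i n\<close> of the last node may be negative, as long as their sum is positive. By Lagrange's
  identity, this sum times the terms at the last node is a square plus a weighted sum of distances
  between the other nodes, which combine with the distances that are already there.
\<close>

lemma Laplacian_nonneg_by_elimination:
  fixes v :: "nat \<Rightarrow> 'a::real_inner"
  assumes deg: "(\<Sum>i<n. w i n) > 0"
    and schur: "\<And>i k. i < k \<Longrightarrow> k < n \<Longrightarrow> 0 \<le> (\<Sum>i<n. w i n) * w i k + w i n * w k n"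
  shows "0 \<le> (\<Sum>k<Suc n. \<Sum>i<k. w i k * (norm (v i - v k))\<^sup>2)"
proof -
  define d where "d = (\<Sum>i<n. w i n)"
  have "d * (\<Sum>k<Suc n. \<Sum>i<k. w i k * (norm (v i - v k))\<^sup>2)
     = d * (\<Sum>k<n. \<Sum>i<k. w i k * (norm (v i - v k))\<^sup>2) + d * (\<Sum>i<n. w i n * (norm (v i - v n))\<^sup>2)"
    by (simp add: distrib_left)
  also have "d * (\<Sum>i<n. w i n * (norm (v i - v n))\<^sup>2)
     = (norm (\<Sum>i<n. w i n *\<^sub>R (v i - v n)))\<^sup>2
       + (\<Sum>k<n. \<Sum>i<k. w i n * w k n * (norm (v i - v k))\<^sup>2)"
    unfolding d_def using Lagrange_identity_weighted[of "\<lambda>i. w i n" n "\<lambda>i. v i - v n"] by simp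
  also have "d * (\<Sum>k<n. \<Sum>i<k. w i k * (norm (v i - v k))\<^sup>2) + \<dots>
     = (norm (\<Sum>i<n. w i n *\<^sub>R (v i - v n)))\<^sup>2
       + (\<Sum>k<n. \<Sum>i<k. (d * w i k + w i n * w k n) * (norm (v i - v k))\<^sup>2)"
    by (simp add: sum_distrib_left sum.distrib algebra_simps)
  also have "\<dots> \<ge> 0"
  proof -
    have "0 \<le> (\<Sum>k<n. \<Sum>i<k. (d * w i k + w i n * w k n) * (norm (v i - v k))\<^sup>2)"
      by (rule sum_nonneg, rule sum_nonneg, rule mult_nonneg_nonneg) (use schur in \<open>auto simp: d_def\<close>)
    then show ?thesis by simp
  qed
  finally show ?thesis using deg by (simp add: d_def zero_le_mult_iff)
qed

section \<open>The multipliers and the weighted sum of the interpolation inequalities\<close>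

text \<open>
  The denominator in the claimed bound is \<open>2 * (\<theta> N)\<^sup>2 * rate N\<close>, by \<open>sum_\<theta>_cube\<close>. So the bound is
  \<open>R\<^sup>2 / (2 * rate N)\<close> for \<open>L = 1\<close>.
\<close>

definition rate :: "nat \<Rightarrow> real" where
  "rate N = (\<theta> N)\<^sup>2 + \<theta>_mean N - 1"

text \<open>
  The multiplier \<open>chain N (Suc k)\<close> of the inequality between \<open>x\<^sub>k\<close> and \<open>x\<^sub>k\<^sub>+\<^sub>1\<close>, divided by \<open>(\<theta> k)\<^sup>2\<close>. The
  classical proof of the rate \<open>1 / (2 * (\<theta> N)\<^sup>2)\<close> takes the constant density \<open>1 / (\<theta> N)\<^sup>2\<close>; the value for
  \<open>k < N\<close> is a correction of relative order \<open>1 / \<theta> N\<close>, namely the solution of the equations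
  \<open>chain_balance\<close>. The value at \<open>N\<close> is fixed by \<open>chain N (Suc N) = 1\<close>, the coefficient of \<open>f x\<^sub>N - f x\<^sub>*\<close>.
\<close>

definition chain_density :: "nat \<Rightarrow> nat \<Rightarrow> real" where
  "chain_density N k = (if k < N
     then (2 * (\<theta> N)\<^sup>2 - (\<theta> k)\<^sup>2 + \<theta>_mean k) / (2 * (\<theta> N)\<^sup>2 - (\<theta> k)\<^sup>2 - \<theta>_mean k + 2 * (\<theta>_mean N - 1))
     else 1) / (\<theta> N)\<^sup>2"

definition chain :: "nat \<Rightarrow> nat \<Rightarrow> real" where
  "chain N k = (case k of 0 \<Rightarrow> 0 | Suc j \<Rightarrow> (\<theta> j)\<^sup>2 * chain_density N j)"

definition star :: "nat \<Rightarrow> nat \<Rightarrow> real" where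
  "star N k = chain N (Suc k) - chain N k"

text \<open>
  The coefficients of the gradients in \<open>(\<theta> k)\<^sup>2 * (x k - z k)\<close>, see \<open>FGM_closed_form\<close>.
\<close>

definition drift :: "nat \<Rightarrow> real" where
  "drift i = (\<theta> i)\<^sup>2 * (\<theta> i - 1)"

text \<open>
  Minus the coefficient of \<open>inner g\<^sub>i g\<^sub>k\<close>, for \<open>i < k\<close>, in the quadratic form that remains after
  completing the square. The product term stems from the completed square. At \<open>k = 0\<close>, where \<open>k - 1\<close> is
  truncated, no such \<open>i\<close> exists.
\<close>

definition coupling :: "nat \<Rightarrow> nat \<Rightarrow> nat \<Rightarrow> real" where
  "coupling N i k = rate N * star N i * star N k - \<theta> i * star N k
     + drift i * (chain_density N k - chain_density N (k - 1))"

lemma chain_simps [simp]: "chain N 0 = 0" "chain N (Suc k) = (\<theta> k)\<^sup>2 * chain_density N k"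
  by (simp_all add: chain_def)

lemma chain_final: "chain N (Suc N) = 1"
  by (simp add: chain_density_def)

lemma sum_star: "(\<Sum>i<k. star N i) = chain N k"
  unfolding star_def by (subst sum_lessThan_telescope) simp

text \<open>
  Partial sums of the weighted interpolation inequalities, with \<open>G k\<close> for the gradient at \<open>x k\<close>. The step
  to \<open>m = n + 1\<close> adds \<open>chain N m\<close> times the inequality between \<open>x n\<close> and \<open>x m\<close> and \<open>star N m\<close> times the
  one between \<open>x_min\<close> and \<open>x m\<close>. Expanding the squared norm turns \<open>x n\<close> into the \<open>y\<close>-iterate \<open>x n - G n\<close>.
  This point and \<open>x m\<close> differ from the same \<open>z\<close>-iterate by \<open>1 / (\<theta> n)\<^sup>2\<close> and by \<open>1 / (\<theta> m)\<^sup>2\<close> times the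
  same vector \<open>W\<close>. Therefore the coefficient of \<open>W\<close> is the increment of \<open>chain_density\<close>.
\<close>

lemma weighted_interpolation_sum:
  fixes x G :: "nat \<Rightarrow> 'a::real_inner"
  assumes chain: "\<And>k. k \<le> N \<Longrightarrow> 0 \<le> chain N k" and star: "\<And>k. k \<le> N \<Longrightarrow> 0 \<le> star N k"
    and x: "\<And>k. k \<le> N \<Longrightarrow> x k = x 0 - (\<Sum>i<k. \<theta> i *\<^sub>R G i) + (1 / (\<theta> k)\<^sup>2) *\<^sub>R (\<Sum>i<k. drift i *\<^sub>R G i)"
    and interp: "\<And>k. F (Suc k) + inner (G (Suc k)) (x k - x (Suc k)) + (norm (G k - G (Suc k)))\<^sup>2 / 2 \<le> F k"
    and interp_min: "\<And>k. F k + inner (G k) (x_min - x k) + (norm (G k))\<^sup>2 / 2 \<le> F_min"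
    and "n \<le> N"
  shows "chain N (Suc n) * (F n - F_min)
    \<le> inner (x 0 - x_min) (\<Sum>k\<le>n. star N k *\<^sub>R G k)
      - (\<Sum>k<n. chain N (Suc k) * (norm (G k))\<^sup>2) - chain N (Suc n) / 2 * (norm (G n))\<^sup>2
      - (\<Sum>k\<le>n. \<Sum>i<k. (\<theta> i * star N k - drift i * (chain_density N k - chain_density N (k - 1))) * inner (G i) (G k))"
  using \<open>n \<le> N\<close>
proof (induction n)
  case 0
  have star0: "star N 0 = chain_density N 0" by (simp add: star_def)
  have *: "chain_density N 0 * (F 0 + inner (G 0) (x_min - x 0) + (norm (G 0))\<^sup>2 / 2) \<le> chain_density N 0 * F_min"
    using interp_min[of 0] star[of 0] star0 by (intro mult_left_mono) auto
  have **: "inner (G 0) (x_min - x 0) = - inner (x 0 - x_min) (G 0)"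
    by (simp add: inner_diff inner_commute)
  have "chain_density N 0 * (F 0 - F_min)
      \<le> chain_density N 0 * inner (x 0 - x_min) (G 0) - chain_density N 0 / 2 * (norm (G 0))\<^sup>2"
    using *[unfolded **] by argo
  then show ?case by (simp add: star0)
next
  case (Suc n)
  define m where "m = Suc n"
  define U W where "U = (\<Sum>i<m. \<theta> i *\<^sub>R G i)" and "W = (\<Sum>i<m. drift i *\<^sub>R G i)"
  define l l' \<mu> \<delta> where "l = chain N m" and "l' = chain N (Suc m)" and "\<mu> = star N m"
    and "\<delta> = chain_density N m - chain_density N n"
  have \<mu>: "\<mu> = l' - l" by (simp add: \<mu>_def l_def l'_def star_def)
  have nonneg: "l \<ge> 0" "\<mu> \<ge> 0" using chain[of m] star[of m] Suc.prems by (auto simp: l_def \<mu>_def m_def)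
  have xm: "x m = x 0 - U + (1 / (\<theta> m)\<^sup>2) *\<^sub>R W"
    using x[of m] Suc.prems by (simp add: U_def W_def m_def)
  have "x n - G n = x 0 - U + (1 / (\<theta> n)\<^sup>2) *\<^sub>R W"
  proof -
    have "(1 / (\<theta> n)\<^sup>2) *\<^sub>R (drift n *\<^sub>R G n) = (\<theta> n - 1) *\<^sub>R G n"
      by (simp add: drift_def)
    then show ?thesis using x[of n] Suc.prems
      by (simp add: U_def W_def m_def scaleR_add_right scaleR_diff_left)
  qed
  then have xn: "x n = G n + x 0 - U + (1 / (\<theta> n)\<^sup>2) *\<^sub>R W" by (simp add: algebra_simps)
  have l: "l / (\<theta> n)\<^sup>2 = chain_density N n" and l': "l' / (\<theta> m)\<^sup>2 = chain_density N m"
    by (simp_all add: l_def l'_def m_def)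
  have "l *\<^sub>R (x m - (x n - G n)) + \<mu> *\<^sub>R (x m - x_min)
      = \<mu> *\<^sub>R (x 0 - x_min) - \<mu> *\<^sub>R U + (l' / (\<theta> m)\<^sup>2 - l / (\<theta> n)\<^sup>2) *\<^sub>R W"
    unfolding xm xn \<mu> by (simp add: algebra_simps diff_divide_distrib)
  then have dir: "l *\<^sub>R (x m - x n) = \<mu> *\<^sub>R (x 0 - x_min) - \<mu> *\<^sub>R U + \<delta> *\<^sub>R W - l *\<^sub>R G n - \<mu> *\<^sub>R (x m - x_min)"
    unfolding l l' \<delta>_def by (simp add: algebra_simps)
  have "l * (F m + inner (G m) (x n - x m) + (norm (G n - G m))\<^sup>2 / 2) \<le> l * F n"
    using interp[of n] nonneg by (intro mult_left_mono) (auto simp: m_def)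
  moreover have "\<mu> * (F m + inner (G m) (x_min - x m) + (norm (G m))\<^sup>2 / 2) \<le> \<mu> * F_min"
    using interp_min[of m] nonneg by (intro mult_left_mono) auto
  moreover have "l * inner (G m) (x n - x m) = - inner (G m) (l *\<^sub>R (x m - x n))"
    by (simp add: inner_diff_right algebra_simps)
  moreover have "inner (G m) (l *\<^sub>R (x m - x n)) = \<mu> * inner (G m) (x 0 - x_min) - \<mu> * inner (G m) U
     + \<delta> * inner (G m) W - l * inner (G n) (G m) + \<mu> * inner (G m) (x_min - x m)"
    unfolding dir by (simp add: inner_diff_right inner_add_right inner_commute[of "G m" "G n"] algebra_simps)
  ultimately have step: "l' * (F m - F_min) \<le> l * (F n - F_min) + \<mu> * inner (x 0 - x_min) (G m)
      - l / 2 * (norm (G n))\<^sup>2 - l' / 2 * (norm (G m))\<^sup>2 - (\<mu> * inner (G m) U - \<delta> * inner (G m) W)"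
    unfolding inner_commute[of "x 0 - x_min" "G m"] \<mu> norm_square_diff[of "G n" "G m"]
    by argo
  have cross: "\<mu> * inner (G m) U - \<delta> * inner (G m) W
      = (\<Sum>i<m. (\<theta> i * \<mu> - drift i * \<delta>) * inner (G i) (G m))"
  proof -
    have "inner (G m) (\<Sum>i<m. a i *\<^sub>R G i) = (\<Sum>i<m. a i * inner (G i) (G m))" for a
      by (simp add: inner_sum_right inner_commute)
    then show ?thesis
      unfolding U_def W_def
      by (simp add: sum_distrib_left flip: sum_subtractf) (rule sum.cong, auto simp: algebra_simps)
  qed
  have IH: "l * (F n - F_min)
    \<le> inner (x 0 - x_min) (\<Sum>k\<le>n. star N k *\<^sub>R G k)
      - (\<Sum>k<n. chain N (Suc k) * (norm (G k))\<^sup>2) - l / 2 * (norm (G n))\<^sup>2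
      - (\<Sum>k\<le>n. \<Sum>i<k. (\<theta> i * star N k - drift i * (chain_density N k - chain_density N (k - 1))) * inner (G i) (G k))"
    using Suc.IH Suc.prems unfolding l_def m_def by simp
  have "l' * (F m - F_min)
    \<le> inner (x 0 - x_min) ((\<Sum>k\<le>n. star N k *\<^sub>R G k) + \<mu> *\<^sub>R G m)
      - ((\<Sum>k<n. chain N (Suc k) * (norm (G k))\<^sup>2) + l * (norm (G n))\<^sup>2) - l' / 2 * (norm (G m))\<^sup>2
      - ((\<Sum>k\<le>n. \<Sum>i<k. (\<theta> i * star N k - drift i * (chain_density N k - chain_density N (k - 1))) * inner (G i) (G k))
        + (\<Sum>i<m. (\<theta> i * \<mu> - drift i * \<delta>) * inner (G i) (G m)))"
    using IH step unfolding cross inner_add_right inner_scaleR_right by linarith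
  then show ?case unfolding l'_def l_def \<mu>_def \<delta>_def m_def by simp
qed

lemma sum_drift: "2 * (\<Sum>i\<le>k. drift i) = (\<theta> k)^4 - \<theta>_mean k * (\<theta> k)\<^sup>2"
proof -
  have "drift i = (\<theta> i)^3 - (\<theta> i)\<^sup>2" for i
    by (simp add: drift_def algebra_simps power2_eq_square power3_eq_cube)
  then show ?thesis using sum_\<theta>_cube[of k] sum_\<theta>_square[of k] by (simp add: sum_subtractf)
qed

section \<open>The row sums of the couplings\<close>

lemma chain_ratio_denominator_pos:
  assumes "1 \<le> t" "t + 1/2 \<le> h" "u \<le> 2/3 * t + 1/3" "2/3 * h - 3/4 \<le> r"
  shows "0 < 2 * h\<^sup>2 - t\<^sup>2 - u + 2 * (r::real)"
proof -
  have "t * t \<le> h * h" using assms by (intro mult_mono) auto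
  moreover have "3/2 * (3/2) \<le> h * h" using assms by (intro mult_mono) auto
  ultimately show ?thesis using assms unfolding power2_eq_square by argo
qed

lemma \<theta>_bounds:
  assumes "k < N"
  shows "1 \<le> \<theta> k" "\<theta> k + 1/2 \<le> \<theta> N" "2/3 * \<theta> k + 1/4 \<le> \<theta>_mean k" "\<theta>_mean k \<le> 2/3 * \<theta> k + 1/3"
    "2/3 * \<theta> N - 3/4 \<le> \<theta>_mean N - 1" "\<theta>_mean N - 1 \<le> 2/3 * \<theta> N - 2/3"
    "0 < 2 * (\<theta> N)\<^sup>2 - (\<theta> k)\<^sup>2 - \<theta>_mean k + 2 * (\<theta>_mean N - 1)"
proof -
  show b: "1 \<le> \<theta> k" "2/3 * \<theta> k + 1/4 \<le> \<theta>_mean k" "\<theta>_mean k \<le> 2/3 * \<theta> k + 1/3"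
    "2/3 * \<theta> N - 3/4 \<le> \<theta>_mean N - 1" "\<theta>_mean N - 1 \<le> 2/3 * \<theta> N - 2/3"
    using \<theta>_ge_1[of k] \<theta>_mean_ge[of k] \<theta>_mean_le[of k] \<theta>_mean_ge[of N] \<theta>_mean_le[of N] by simp_all
  show h: "\<theta> k + 1/2 \<le> \<theta> N"
  proof -
    have "\<theta> k + 1/2 \<le> \<theta> k + (real N - real k) / 2" using assms by simp
    also have "\<dots> \<le> \<theta> N" using assms by (intro \<theta>_mono) simp
    finally show ?thesis .
  qed
  show "0 < 2 * (\<theta> N)\<^sup>2 - (\<theta> k)\<^sup>2 - \<theta>_mean k + 2 * (\<theta>_mean N - 1)"
    using chain_ratio_denominator_pos b h by blast
qed

lemma chain_density_less: "k < N \<Longrightarrow> chain_density N k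
    = (2 * (\<theta> N)\<^sup>2 - (\<theta> k)\<^sup>2 + \<theta>_mean k) / (2 * (\<theta> N)\<^sup>2 - (\<theta> k)\<^sup>2 - \<theta>_mean k + 2 * (\<theta>_mean N - 1)) / (\<theta> N)\<^sup>2"
  by (simp add: chain_density_def)

lemma chain_density_last: "chain_density N N = 1 / (\<theta> N)\<^sup>2"
  by (simp add: chain_density_def)

text \<open>
  The equation that determines \<open>chain N k\<close> and thereby all multipliers. Its difference for \<open>k\<close> and
  \<open>k + 1\<close> says that row \<open>k\<close> of the quadratic form sums to zero.
\<close>

lemma chain_balance:
  assumes "k \<le> N"
  shows "chain N k * (rate N - ((\<theta> k)\<^sup>2 - \<theta> k)) + chain_density N (k - 1) * (\<Sum>i<k. drift i)
     = ((\<theta> k)\<^sup>2 - \<theta> k) - (\<Sum>i<k. drift i) / (\<theta> N)\<^sup>2"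
proof (cases k)
  case (Suc j)
  define A t u c D where "A = (\<theta> N)\<^sup>2" and "t = (\<theta> j)\<^sup>2" and "u = \<theta>_mean j" and "c = chain_density N j"
    and "D = 2 * A - t - u + 2 * (\<theta>_mean N - 1)"
  have A: "A > 0" by (simp add: A_def)
  have D: "D > 0" using \<theta>_bounds(7)[of j N] Suc assms by (simp add: A_def t_def u_def D_def)
  have "c * D = (2 * A - t + u) / A"
    using D chain_density_less[of j N] Suc assms by (simp add: A_def t_def u_def c_def D_def)
  then have "A * (c * D) = 2 * A - t + u" using A by simp
  then have "t * (A * (c * D)) = t * (2 * A - t + u)" by simp
  then have *: "c * t * (A + \<theta>_mean N - 1 - t) * A + c * ((t * t - u * t) / 2) * A = t * A - (t * t - u * t) / 2"
    unfolding D_def by (simp add: field_simps)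
  have "(\<Sum>i<k. drift i) = (t * t - u * t) / 2"
    using sum_drift[of j] Suc
    by (simp add: t_def u_def lessThan_Suc_atMost power2_eq_square power4_eq_xxxx)
  moreover have "(\<theta> k)\<^sup>2 - \<theta> k = t" using \<theta>_square_Suc[of j] Suc by (simp add: t_def)
  moreover have "(t * c) * (A + \<theta>_mean N - 1 - t) + c * ((t * t - u * t) / 2) = t - (t * t - u * t) / 2 / A"
    using * A by (simp add: field_simps)
  moreover have "rate N = A + \<theta>_mean N - 1" "chain N k = t * c" "chain_density N (k - 1) = c"
    using Suc by (simp_all add: rate_def A_def c_def t_def)
  ultimately show ?thesis unfolding A_def by metis
qed simp

text \<open>
  The right-hand side is the coefficient of \<open>(norm g\<^sub>k)\<^sup>2\<close> in twice the quadratic form. Both sums are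
  evaluated by telescoping, and the result is compared with \<open>chain_balance\<close> at \<open>k\<close> and \<open>k + 1\<close>. In the
  last row there is no second equation; there the value of \<open>rate N\<close> closes the gap.
\<close>

lemma coupling_row_sum:
  assumes "k \<le> N"
  shows "(\<Sum>i<k. coupling N i k) + (\<Sum>j=Suc k..<Suc N. coupling N k j)
    = (if k < N then 2 * chain N (Suc k) else 1) - rate N * (star N k)\<^sup>2"
proof -
  define R t a p B A where "R = rate N" and "t = \<theta> k" and "a = t\<^sup>2 - t" and "p = drift k"
    and "B = (\<Sum>i<k. drift i)" and "A = (\<theta> N)\<^sup>2"
  define c c' l l' s where "c = chain_density N (k - 1)" and "c' = chain_density N k" and "l = chain N k"
    and "l' = chain N (Suc k)" and "s = star N k"
  have s: "s = l' - l" by (simp add: s_def star_def l_def l'_def)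
  have l': "l' = t\<^sup>2 * c'" by (simp add: l'_def t_def c'_def)
  have "(\<Sum>i<k. coupling N i k) = (\<Sum>i<k. (R * s) * star N i - \<theta> i * s + drift i * (c' - c))"
    by (intro sum.cong) (simp_all add: coupling_def R_def s_def c_def c'_def)
  also have "\<dots> = R * s * l - a * s + B * (c' - c)"
    by (simp add: sum.distrib sum_subtractf sum_star sum_\<theta> l_def a_def t_def B_def
        flip: sum_distrib_left sum_distrib_right)
  finally have left: "(\<Sum>i<k. coupling N i k) = R * s * l - a * s + B * (c' - c)" .
  have "(\<Sum>j=Suc k..<Suc N. star N j) = 1 - l'"
    using assms unfolding star_def l'_def by (subst sum_Suc_diff') (auto simp: chain_final simp del: chain_simps)
  moreover have "(\<Sum>j=Suc k..<Suc N. chain_density N j - chain_density N (j - 1)) = 1 / A - c'"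
    using assms unfolding sum.shift_bounds_Suc_ivl
    by (simp add: sum_Suc_diff' chain_density_last c'_def A_def)
  moreover have "(\<Sum>j=Suc k..<Suc N. coupling N k j)
      = (R * s - t) * (\<Sum>j=Suc k..<Suc N. star N j) + p * (\<Sum>j=Suc k..<Suc N. chain_density N j - chain_density N (j - 1))"
    unfolding sum_distrib_left sum.distrib[symmetric]
    by (intro sum.cong) (simp_all add: coupling_def R_def s_def t_def p_def algebra_simps)
  ultimately have right: "(\<Sum>j=Suc k..<Suc N. coupling N k j) = (R * s - t) * (1 - l') + p * (1 / A - c')"
    by simp
  have bal: "l * (R - a) + c * B = a - B / A"
    using chain_balance[OF assms] by (simp add: l_def R_def a_def t_def c_def B_def A_def)
  have p: "p = t\<^sup>2 * t - t\<^sup>2" by (simp add: p_def drift_def t_def algebra_simps)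
  show ?thesis
  proof (cases "k < N")
    case True
    have "l' * (R - t\<^sup>2) + c' * (B + p) = t\<^sup>2 - (B + p) / A"
      using chain_balance[of "Suc k" N] True \<theta>_square_Suc[of k]
      by (simp add: l'_def R_def t_def c'_def B_def A_def p_def)
    with bal have "R * s = t - p / A + l' * t\<^sup>2 - l * a - c' * (B + p) + c * B"
      unfolding s a_def by (simp add: algebra_simps add_divide_distrib)
    then have "R * s - a * s + B * (c' - c) - t + t * l' + p / A - p * c' = 2 * t * l' - 2 * p * c'"
      unfolding s a_def by (simp add: algebra_simps)
    also have "\<dots> = 2 * l'" unfolding l' p by (simp add: algebra_simps)
    finally have "R * s - a * s + B * (c' - c) - t + t * l' + p / A - p * c' = 2 * l'" .
    moreover have "R * s * l + R * s * (1 - l') = R * s - R * s\<^sup>2"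
      unfolding s by (simp add: algebra_simps power2_eq_square)
    ultimately show ?thesis using True unfolding left right l'_def[symmetric] R_def[symmetric] s_def[symmetric]
      by (simp add: algebra_simps)
  next
    case False
    then have k: "k = N" using assms by simp
    have A: "A = t\<^sup>2" "A > 0" by (simp_all add: A_def t_def k)
    have l'1: "l' = 1" and c': "c' = 1 / A"
      unfolding l'_def c'_def k A_def chain_final chain_density_last by simp_all
    have B: "2 * B = a\<^sup>2 - (\<theta>_mean N - 1) * A"
    proof -
      have "2 * B = 2 * (\<Sum>i\<le>N. drift i) - 2 * p"
        by (simp add: B_def k p_def lessThan_Suc_atMost[symmetric])
      also have "\<dots> = A\<^sup>2 - \<theta>_mean N * A - 2 * (t\<^sup>2 * t - t\<^sup>2)"
        unfolding sum_drift p by (simp add: A_def power2_eq_square power4_eq_xxxx)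
      also have "\<dots> = a\<^sup>2 - (\<theta>_mean N - 1) * A"
        unfolding a_def A(1) by (simp add: algebra_simps power2_eq_square)
      finally show ?thesis .
    qed
    have "R * s - a * s + B * (1 / A - c) = (R - a) - (l * (R - a) + c * B) + B / A"
      unfolding s l'1 by (simp add: algebra_simps)
    also have "\<dots> = R - 2 * a + 2 * B / A" unfolding bal by simp
    also have "\<dots> = A - 2 * a + a\<^sup>2 / A"
      using A(2) unfolding B R_def rate_def A_def by (simp add: field_simps)
    also have "\<dots> = (t\<^sup>2 - a)\<^sup>2 / A"
      unfolding A(1)[symmetric] using A(2) by (simp add: field_simps power2_eq_square)
    also have "\<dots> = 1" using A by (simp add: a_def)
    finally have "R * s - a * s + B * (1 / A - c) = 1" .
    moreover have "R * s * l = R * s - R * s\<^sup>2"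
      unfolding s l'1 by (simp add: algebra_simps power2_eq_square)
    ultimately show ?thesis unfolding left right c' using False
      by (simp add: k l'1 s_def R_def)
  qed
qed

lemma coupling_last_sum: "(\<Sum>i<N. coupling N i N) = 1 - rate N * (star N N)\<^sup>2"
  using coupling_row_sum[of N N] by simp

section \<open>Polynomial inequalities\<close>

text \<open>
  In the variables \<open>a = t - 1\<close> and \<open>b = h - t\<close> the difference of the two sides has nonnegative
  coefficients. For large \<open>h\<close> the two sides agree at \<open>t = h\<close> to leading order.
\<close>

lemma drift_polynomial_bound:
  fixes h t :: real
  assumes t: "1 \<le> t" and h: "t \<le> h"
  shows "(t - 1) * h * (2 * h\<^sup>2 - t\<^sup>2 - 2/3 * t + 4/3 * (h - 1))
     \<le> (h - 1) * (h + 1/3) * (2 * h\<^sup>2 - (h - 1) * (t - 2/3))"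
proof -
  obtain a b where ab: "t = 1 + a" "h = 1 + a + b" "a \<ge> 0" "b \<ge> 0"
    using t h by (metis add.commute diff_add_cancel diff_ge_0_iff_ge)
  have "(h - 1) * (h + 1/3) * (2 * h\<^sup>2 - (h - 1) * (t - 2/3))
      - (t - 1) * h * (2 * h\<^sup>2 - t\<^sup>2 - 2/3 * t + 4/3 * (h - 1))
     = 3*a^2*b^2 + 5*a*b^3 + 2*b^4 + 4/3*a^3 + 13/3*a^2*b + 31/3*a*b^2 + 19/3*b^3 + 35/9*a^2
       + 73/9*a*b + 62/9*b^2 + 7/3*a + 8/3*b"
    unfolding ab by (simp add: field_simps power2_eq_square power3_eq_cube power4_eq_xxxx)
  also have "\<dots> \<ge> 0" using ab by simp
  finally show ?thesis by simp
qed

text \<open>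
  Estimate \<open>(t\<^sup>2 - u) / h\<^sup>2\<close> by \<open>1\<close> where it is multiplied by \<open>r\<close>. What remains of the difference of the
  sides increases with \<open>r\<close> and decreases with \<open>u\<close>. At the extreme values \<open>r = 2/3 * h - 3/4\<close> and
  \<open>u = 2/3 * t + 1/3\<close> it is a polynomial with nonnegative coefficients in \<open>a = t - 1\<close> and
  \<open>b = h - t - 1/2\<close>.
\<close>

lemma star_polynomial_bound:
  fixes h t u r :: real
  assumes t: "1 \<le> t" and h: "t + 1/2 \<le> h" and u: "0 \<le> u" "u \<le> 2/3 * t + 1/3"
    and r: "2/3 * h - 3/4 \<le> r" "r \<le> 2/3 * h - 2/3"
  shows "(h\<^sup>2 + r) * (2 * h\<^sup>2 - t\<^sup>2 + 2 * t - u + 4/3 * (t\<^sup>2 - u) / h\<^sup>2)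
     \<le> (h\<^sup>2 + 3/2 * h) * (2 * h\<^sup>2 - t\<^sup>2 - u + 2 * r)"
proof -
  define a b where "a = t - 1" and "b = h - t - 1/2"
  have ab: "t = 1 + a" "h = 3/2 + a + b" "a \<ge> 0" "b \<ge> 0"
    using t h by (simp_all add: a_def b_def)
  define g where "g = (t\<^sup>2 - u) / h\<^sup>2"
  have "h > 0" using t h by simp
  have "t * t \<le> h * h" using t h by (intro mult_mono) auto
  then have g: "g \<le> 1" and hg: "h\<^sup>2 * g = t\<^sup>2 - u"
    using u \<open>h > 0\<close> by (simp_all add: g_def power2_eq_square)
  define K where "K = 3/2 * h + t\<^sup>2 / 2 - t + u / 2"
  have "K - 2/3 = 3/2 * h + (t - 1)\<^sup>2 / 2 + u / 2 - 7/6"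
    by (simp add: K_def power2_eq_square field_simps)
  then have K: "K - 2/3 \<ge> 0" using t h u zero_le_power2[of "t - 1"] by argo
  have "0 \<le> 1/12*a^3 + 25/12*a^2*b + 7/2*a*b^2 + 3/2*b^3 + 11/36*a^2 + 157/18*a*b + 27/4*b^2 + a
      + 127/18*b + 23/24"
    using ab by simp
  also have "\<dots> = h\<^sup>2 * (3/2 * h - t) - 2/3 * (t\<^sup>2 - (2/3 * t + 1/3))
      + (2/3 * h - 3/4) * (3/2 * h + t\<^sup>2 / 2 - t + (2/3 * t + 1/3) / 2 - 2/3)
      - 3/4 * h * (t\<^sup>2 + (2/3 * t + 1/3))"
    unfolding ab by (simp add: field_simps power2_eq_square power3_eq_cube)
  also have "\<dots> = h\<^sup>2 * (3/2 * h - t) - 2/3 * (t\<^sup>2 - u) + (2/3 * h - 3/4) * (K - 2/3)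
      - 3/4 * h * (t\<^sup>2 + u) - (2/3 * t + 1/3 - u) * (5/12 * h - 7/24)"
    unfolding K_def by (simp add: field_simps power2_eq_square)
  also have "\<dots> \<le> h\<^sup>2 * (3/2 * h - t) - 2/3 * (t\<^sup>2 - u) + (2/3 * h - 3/4) * (K - 2/3) - 3/4 * h * (t\<^sup>2 + u)"
    using u t h by (simp add: mult_nonneg_nonneg)
  also have "\<dots> \<le> h\<^sup>2 * (3/2 * h - t) - 2/3 * (t\<^sup>2 - u) + r * (K - 2/3 * g) - 3/4 * h * (t\<^sup>2 + u)"
  proof -
    have "(2/3 * h - 3/4) * (K - 2/3) \<le> r * (K - 2/3)" using r K by (intro mult_right_mono)
    also have "\<dots> \<le> r * (K - 2/3 * g)" using r t h g by (intro mult_left_mono) auto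
    finally show ?thesis by simp
  qed
  also have "\<dots> = ((h\<^sup>2 + 3/2 * h) * (2 * h\<^sup>2 - t\<^sup>2 - u + 2 * r)
      - (h\<^sup>2 + r) * (2 * h\<^sup>2 - t\<^sup>2 + 2 * t - u + 4/3 * g)) / 2 + 2/3 * (h\<^sup>2 * g - (t\<^sup>2 - u))"
    unfolding K_def by (simp add: field_simps power2_eq_square)
  finally show ?thesis unfolding hg by (simp add: g_def)
qed

text \<open>
  With \<open>a = h - 2\<close> and \<open>s = r - (2/3 * h - 3/4)\<close> the difference of the sides is a polynomial in which only
  the coefficients of \<open>a * s^3\<close> and \<open>s^3\<close> are negative; they are absorbed by those of \<open>a * s\<^sup>2\<close> and \<open>s\<^sup>2\<close>.
\<close>

lemma degree_polynomial_bound: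
  fixes h r :: real
  assumes "2 \<le> h" and r: "2/3 * h - 3/4 \<le> r" "r \<le> 2/3 * h - 2/3" and M: "M = h\<^sup>2 + h + r - 1/2"
  shows "(h\<^sup>2 + r) * (M - 2 * r)\<^sup>2 * (h + 6) \<le> h\<^sup>2 * (h + 4) * M\<^sup>2"
proof -
  define a s where "a = h - 2" and "s = r - (2/3 * h - 3/4)"
  have h: "h = 2 + a" and r': "r = 7/12 + 2/3 * a + s" and as: "a \<ge> 0" "s \<ge> 0" "s \<le> 1"
    using assms by (simp_all add: a_def s_def field_simps)
  have "h\<^sup>2 * (h + 4) * M\<^sup>2 - (h\<^sup>2 + r) * (M - 2 * r)\<^sup>2 * (h + 6)
     = 3*a^5* s + 191/36*a^5 + 146/3*a^4* s + 2*a^3* s^2 + 2597/54*a^4 + 287*a^3* s + 22*a^2* s^2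
       + a* s^2*(1 - s) + 33967/216*a^3 + 2330/3*a^2* s + 257/4*a* s^2 + 8* s^2*(1 - s) + 5323/24*a^2
       + 15641/16*a* s + 58* s^2 + 199025/1728*a + 2755/6* s + 389/216"
    unfolding M h r' by (simp add: field_simps power_numeral_reduce)
  also have "\<dots> \<ge> 0" using as by (intro add_nonneg_nonneg mult_nonneg_nonneg zero_le_power) auto
  finally show ?thesis by simp
qed

lemma degree_polynomial_pos:
  fixes h r :: real
  assumes "1 \<le> h" "0 < r" "r \<le> h" and M: "M = h\<^sup>2 + h + r"
  shows "(h\<^sup>2 + r) * (M - 2 * r)\<^sup>2 < h\<^sup>2 * M\<^sup>2"
proof -
  have "h\<^sup>2 * M\<^sup>2 - (h\<^sup>2 + r) * (M - 2 * r)\<^sup>2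
      = h\<^sup>2 * r * (h\<^sup>2 - 1) + 2 * h^4 * r + 2 * h^3 * r + 2 * h\<^sup>2 * r\<^sup>2 + h * r\<^sup>2 + r\<^sup>2 * (h - r)"
    unfolding M by (simp add: field_simps power_numeral_reduce)
  also have "\<dots> > 0"
    using assms by (intro add_pos_nonneg add_nonneg_pos mult_nonneg_nonneg mult_pos_pos) auto
  finally show ?thesis by simp
qed

section \<open>Estimates of the multipliers\<close>

lemma chain_density_pos: "k \<le> N \<Longrightarrow> 0 < chain_density N k"
proof (cases "k < N")
  case True
  have "(\<theta> k)\<^sup>2 \<le> (\<theta> N)\<^sup>2"
    using \<theta>_bounds(1,2)[OF True] by (intro power_mono) auto
  then have "0 < 2 * (\<theta> N)\<^sup>2 - (\<theta> k)\<^sup>2 + \<theta>_mean k"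
    using \<theta>_bounds(1,3)[OF True] zero_le_power2[of "\<theta> N"] by linarith
  then show ?thesis using \<theta>_bounds(7)[OF True] by (simp add: chain_density_less[OF True])
qed (simp add: chain_density_last)

text \<open>
  Clearing denominators, the claim is \<open>t * (r - u) \<le> (u - v) * (X + r)\<close>. The mean increases by
  \<open>u - v \<ge> 1/3\<close>, while \<open>r - u \<le> 2/3 * (\<theta> N - t)\<close>; what is left is \<open>2 * t * (\<theta> N - t) \<le> X\<close>, where
  \<open>X\<close> exceeds the left-hand side by the sum of the squares of \<open>\<theta> N\<close> and \<open>\<theta> N - t\<close>.
\<close>

lemma chain_density_Suc_ge:
  assumes "Suc k < N"
  shows "chain_density N k \<le> chain_density N (Suc k)"
proof -
  define A t u v r where "A = (\<theta> N)\<^sup>2" and "t = \<theta> (Suc k)" and "u = \<theta>_mean (Suc k)" and "v = \<theta>_mean k" and "r = \<theta>_mean N - 1"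
  define X where "X = 2 * A - t\<^sup>2"
  have b: "1 \<le> t" "t + 1/2 \<le> \<theta> N" "2/3 * t \<le> u" "r \<le> 2/3 * \<theta> N" "2/3 * \<theta> N - 3/4 \<le> r"
    using \<theta>_bounds[OF assms] by (simp_all add: t_def u_def r_def)
  have prev: "(\<theta> k)\<^sup>2 = t\<^sup>2 - t" using \<theta>_square_Suc[of k] by (simp add: t_def)
  have u: "u = 1 + v * (1 - 1 / t)" by (simp add: u_def v_def t_def \<theta>_mean.simps(2))
  have "v \<le> 2/3 * t" using \<theta>_mean_le[of k] \<theta>_Suc_ge[of k] by (simp add: v_def t_def)
  then have "v / t \<le> 2/3" using b by (simp add: field_simps)
  moreover have "u - v = 1 - v / t" unfolding u by (simp add: algebra_simps)
  ultimately have uv: "1/3 \<le> u - v" by linarith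
  have den: "0 < X - u + 2 * r" "0 < X + t - v + 2 * r"
    using \<theta>_bounds(7)[OF assms] \<theta>_bounds(7)[of k N] assms
    unfolding prev by (simp_all add: X_def A_def t_def[symmetric] u_def v_def r_def)
  have sq: "0 \<le> (\<theta> N)\<^sup>2 + (\<theta> N - t)\<^sup>2" by simp
  have h: "2 * t * (\<theta> N - t) \<le> X"
    using sq by (simp add: X_def A_def power2_eq_square algebra_simps)
  moreover have "0 \<le> 2 * t * (\<theta> N - t)" using b by (intro mult_nonneg_nonneg) auto
  ultimately have X: "0 \<le> X + r" using b by linarith
  have "t * (r - u) \<le> t * (2/3 * (\<theta> N - t))" using b by (intro mult_left_mono) auto
  also have "\<dots> \<le> 1/3 * (X + r)" using h b by (simp add: algebra_simps)
  also have "\<dots> \<le> (u - v) * (X + r)" using uv X by (intro mult_right_mono)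
  finally have "0 \<le> 2 * ((u - v) * (X + r) + t * (u - r))" by (simp add: algebra_simps)
  also have "\<dots> = (X + u) * (X + t - v + 2 * r) - (X + t + v) * (X - u + 2 * r)"
    by (simp add: algebra_simps)
  finally have "(X + t + v) / (X + t - v + 2 * r) \<le> (X + u) / (X - u + 2 * r)"
    using den by (simp add: divide_simps mult.commute)
  then have "(X + t + v) / (X + t - v + 2 * r) / A \<le> (X + u) / (X - u + 2 * r) / A"
    by (intro divide_right_mono) (simp_all add: A_def)
  moreover have "2 * A - (\<theta> k)\<^sup>2 = X + t" by (simp add: prev X_def)
  ultimately show ?thesis
    unfolding chain_density_less[OF assms] chain_density_less[OF Suc_lessD[OF assms]]
    by (simp only: A_def[symmetric] t_def[symmetric] X_def[symmetric] u_def[symmetric] v_def[symmetric]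
        r_def[symmetric])
qed

lemma chain_density_mono: "j \<le> k \<Longrightarrow> k < N \<Longrightarrow> chain_density N j \<le> chain_density N k"
proof (induction k rule: dec_induct)
  case (step n) then show ?case using chain_density_Suc_ge[of n N] by simp
qed simp

text \<open>
  Times \<open>\<theta> k\<close>, this excess is a lower bound for \<open>rate N * star N k - \<theta> k\<close>, the factor of \<open>star N j\<close> in
  \<open>coupling N k j\<close>.
\<close>

lemma rate_excess:
  assumes "k < N"
  shows "rate N * chain_density N k - 1 = (2 * (\<theta> N)\<^sup>2 * \<theta>_mean k - (\<theta>_mean N - 1) * ((\<theta> k)\<^sup>2 - \<theta>_mean k))
      / ((\<theta> N)\<^sup>2 * (2 * (\<theta> N)\<^sup>2 - (\<theta> k)\<^sup>2 - \<theta>_mean k + 2 * (\<theta>_mean N - 1)))"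
proof -
  define A r where "A = (\<theta> N)\<^sup>2" and "r = \<theta>_mean N - 1"
  define D where "D = 2 * A - (\<theta> k)\<^sup>2 - \<theta>_mean k + 2 * r"
  have "D > 0" "A > 0" using \<theta>_bounds(7)[OF assms] by (simp_all add: D_def A_def r_def)
  have "(A + r) * ((2 * A - (\<theta> k)\<^sup>2 + \<theta>_mean k) / D / A) - 1 = ((A + r) * (2 * A - (\<theta> k)\<^sup>2 + \<theta>_mean k) - A * D) / (A * D)"
    using \<open>D > 0\<close> \<open>A > 0\<close> by (simp add: field_simps)
  moreover have "(A + r) * (2 * A - (\<theta> k)\<^sup>2 + \<theta>_mean k) - A * D = 2 * A * \<theta>_mean k - r * ((\<theta> k)\<^sup>2 - \<theta>_mean k)"
    by (simp add: D_def algebra_simps)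
  moreover have "rate N = A + r" by (simp add: rate_def A_def r_def)
  ultimately show ?thesis
    unfolding chain_density_less[OF assms] by (simp only: A_def D_def r_def)
qed

lemma rate_excess_numerator:
  assumes "k < N"
  shows "2/3 * \<theta> k * (2 * (\<theta> N)\<^sup>2 - (\<theta> N - 1) * (\<theta> k - 2/3))
    \<le> 2 * (\<theta> N)\<^sup>2 * \<theta>_mean k - (\<theta>_mean N - 1) * ((\<theta> k)\<^sup>2 - \<theta>_mean k)"
proof -
  define h t u r where "h = \<theta> N" and "t = \<theta> k" and "u = \<theta>_mean k" and "r = \<theta>_mean N - 1"
  have b: "1 \<le> t" "t + 1/2 \<le> h" "2/3 * t \<le> u" "r \<le> 2/3 * (h - 1)" "0 \<le> r"
    using \<theta>_bounds[OF assms] by (simp_all add: h_def t_def u_def r_def)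
  have "r * (t\<^sup>2 - u) \<le> r * (t\<^sup>2 - 2/3 * t)" using b by (intro mult_left_mono) auto
  also have "\<dots> \<le> 2/3 * (h - 1) * (t\<^sup>2 - 2/3 * t)"
  proof (rule mult_right_mono)
    have "1 * t \<le> t * t" using b by (intro mult_right_mono) auto
    then show "0 \<le> t\<^sup>2 - 2/3 * t" using b unfolding power2_eq_square by linarith
  qed (use b in simp)
  finally have "r * (t\<^sup>2 - u) \<le> 2/3 * (h - 1) * (t\<^sup>2 - 2/3 * t)" .
  moreover have "2 * h\<^sup>2 * (2/3 * t) \<le> 2 * h\<^sup>2 * u" using b by (intro mult_left_mono) auto
  moreover have "2/3 * t * (2 * h\<^sup>2 - (h - 1) * (t - 2/3))
      = 2 * h\<^sup>2 * (2/3 * t) - 2/3 * (h - 1) * (t\<^sup>2 - 2/3 * t)"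
    by (simp add: power2_eq_square field_simps)
  ultimately have "2/3 * t * (2 * h\<^sup>2 - (h - 1) * (t - 2/3)) \<le> 2 * h\<^sup>2 * u - r * (t\<^sup>2 - u)"
    by linarith
  then show ?thesis by (simp only: h_def t_def u_def r_def)
qed

lemma rate_density_ge_1:
  assumes "k < N"
  shows "1 \<le> rate N * chain_density N k"
proof -
  define h t where "h = \<theta> N" and "t = \<theta> k"
  have b: "1 \<le> t" "t + 1/2 \<le> h" using \<theta>_bounds[OF assms] by (simp_all add: h_def t_def)
  have "(h - 1) * (t - 2/3) \<le> h * h" using b by (intro mult_mono) auto
  moreover have "0 \<le> h * h" by simp
  ultimately have "0 \<le> 2 * h\<^sup>2 - (h - 1) * (t - 2/3)" unfolding power2_eq_square by linarith
  then have "0 \<le> 2/3 * t * (2 * h\<^sup>2 - (h - 1) * (t - 2/3))"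
    using b by (simp add: mult_nonneg_nonneg)
  then have "0 \<le> rate N * chain_density N k - 1"
    unfolding rate_excess[OF assms]
    using rate_excess_numerator[OF assms] \<theta>_bounds(7)[OF assms]
    by (intro divide_nonneg_nonneg mult_nonneg_nonneg) (auto simp: h_def t_def)
  then show ?thesis by simp
qed

text \<open>
  The number \<open>w\<close> is \<open>\<theta>_mean (N - 1) / \<theta> N\<close>. It also is the increment of the mean in the last step
  subtracted from one, which gives the relation between \<open>w\<close> and \<open>r\<close>.
\<close>

lemma last_multipliers:
  assumes "N = Suc n"
  defines "h \<equiv> \<theta> N" and "r \<equiv> \<theta>_mean N - 1"
  obtains w M where "M = h\<^sup>2 + h + r - w" "(h - 1) * w = r" "1/2 \<le> w" "w \<le> 2/3" "0 < M" "0 < M - 2 * r"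
    "M - 2 * r = h * (h + 1 - w)" "chain_density N n = (M + 2 * w) / (M * h\<^sup>2)" "star N N = (M - 2 * r) / (h * M)"
proof -
  have n: "n < N" using assms by simp
  have b: "3/2 \<le> h" "2/3 * h - 3/4 \<le> r" "r \<le> 2/3 * h"
    using \<theta>_bounds[OF n] by (simp_all add: h_def r_def)
  define w M where "w = \<theta>_mean n / h" and "M = h\<^sup>2 + h + r - w"
  have qn: "\<theta>_mean n = h * w" using b by (simp add: w_def)
  have r: "(h - 1) * w = r"
  proof -
    have "r = \<theta>_mean n * (1 - 1 / h)" by (simp add: r_def assms(1) \<theta>_mean.simps(2) h_def)
    then show ?thesis using b unfolding w_def by (simp add: field_simps)
  qed
  have "\<theta>_mean n \<le> 2/3 * h" using \<theta>_mean_le[of n] \<theta>_Suc_ge[of n] by (simp add: h_def assms(1))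
  then have w: "w \<le> 2/3" using b by (simp add: w_def field_simps)
  have "(h - 1) * (1/2) \<le> (h - 1) * w" using b r by simp
  then have w': "1/2 \<le> w" using b by simp
  have Mr: "M - 2 * r = h * (h + 1 - w)"
    unfolding M_def r[symmetric] by (simp add: algebra_simps power2_eq_square)
  moreover have "0 < h * (h + 1 - w)" using b w by (intro mult_pos_pos) auto
  ultimately have pos: "0 < M - 2 * r" "0 < M" using b by auto
  have prev: "(\<theta> n)\<^sup>2 = h\<^sup>2 - h" using \<theta>_square_Suc[of n] by (simp add: h_def assms(1))
  have "2 * h\<^sup>2 - (h\<^sup>2 - h) + \<theta>_mean n = M + 2 * w" "2 * h\<^sup>2 - (h\<^sup>2 - h) - \<theta>_mean n + 2 * r = M"
    unfolding qn M_def r[symmetric] by (simp_all add: algebra_simps)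
  then have chain_density: "chain_density N n = (M + 2 * w) / (M * h\<^sup>2)"
    unfolding chain_density_less[OF n] prev h_def[symmetric] r_def[symmetric] by simp
  have "star N N = 1 - (h\<^sup>2 - h) * chain_density N n"
    using chain_final[of N] prev by (simp add: star_def assms(1))
  also have "\<dots> = (h * M - (h - 1) * (M + 2 * w)) / (h * M)"
    using pos b unfolding chain_density by (simp add: field_simps power2_eq_square)
  also have "h * M - (h - 1) * (M + 2 * w) = M - 2 * r"
    unfolding r[symmetric] by (simp add: algebra_simps)
  finally have "star N N = (M - 2 * r) / (h * M)" .
  then show thesis using that[OF M_def r w' w pos(2) pos(1) Mr chain_density] by simp
qed

lemma star_ge: "k < N \<Longrightarrow> \<theta> k * chain_density N k \<le> star N k"
proof (cases k)
  case (Suc j)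
  assume "k < N"
  then have "(\<theta> j)\<^sup>2 * chain_density N j \<le> (\<theta> j)\<^sup>2 * chain_density N k"
    using chain_density_Suc_ge[of j N] Suc by (intro mult_left_mono) auto
  then show ?thesis using \<theta>_square_Suc[of j] Suc by (simp add: star_def algebra_simps)
qed (simp add: star_def)

lemma star_pos: "k \<le> N \<Longrightarrow> 0 < star N k"
proof (cases "k < N")
  case True
  have "0 < \<theta> k * chain_density N k" using chain_density_pos[of k N] True by simp
  then show ?thesis using star_ge[OF True] by linarith
next
  case False
  assume "k \<le> N"
  with False have k: "k = N" by simp
  show ?thesis
  proof (cases N)
    case 0 then show ?thesis using k by (simp add: star_def chain_density_last)
  next
    case (Suc n)
    obtain w M where "0 < M" "0 < M - 2 * (\<theta>_mean N - 1)" "star N N = (M - 2 * (\<theta>_mean N - 1)) / (\<theta> N * M)"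
      by (rule last_multipliers[OF Suc]) blast
    then show ?thesis by (simp add: k)
  qed
qed

lemma chain_nonneg: "k \<le> N \<Longrightarrow> 0 \<le> chain N k"
  using chain_density_pos[of "k - 1" N] by (cases k) auto

lemma rate_pos: "0 < rate N"
  using \<theta>_mean_ge[of N] \<theta>_ge_1[of N] one_le_power[OF \<theta>_ge_1, of N 2] unfolding rate_def by linarith

text \<open>
  The sum of the couplings with the last gradient, that is the number \<open>1 - rate N * (star N N)\<^sup>2\<close> by
  \<open>coupling_last_sum\<close>, has to be positive for the elimination of this gradient.
\<close>

lemma rate_star_last_less_1:
  assumes "N \<ge> 1"
  shows "rate N * (star N N)\<^sup>2 < 1"
proof -
  obtain n where N: "N = Suc n" using assms by (cases N) auto
  define h r where "h = \<theta> N" and "r = \<theta>_mean N - 1"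
  obtain w M where *: "M = h\<^sup>2 + h + r - w" "1/2 \<le> w" "0 < M" "0 < M - 2 * r" "star N N = (M - 2 * r) / (h * M)"
    by (rule last_multipliers[OF N, folded h_def r_def]) blast
  have b: "3/2 \<le> h" "2/3 * h - 3/4 \<le> r" "r \<le> 2/3 * h"
    using \<theta>_bounds[of n N] N by (simp_all add: h_def r_def)
  define M' where "M' = h\<^sup>2 + h + r"
  have "M \<le> M'" using * by (simp add: M'_def)
  then have "(M - 2 * r) / M \<le> (M' - 2 * r) / M'"
    using * b by (simp add: field_simps)
  then have "((M - 2 * r) / M)\<^sup>2 \<le> ((M' - 2 * r) / M')\<^sup>2"
    using * by (intro power_mono) auto
  moreover have "(h\<^sup>2 + r) * (M' - 2 * r)\<^sup>2 < h\<^sup>2 * M'\<^sup>2"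
    using b by (intro degree_polynomial_pos) (auto simp: M'_def)
  then have "(h\<^sup>2 + r) / h\<^sup>2 * ((M' - 2 * r) / M')\<^sup>2 < 1"
    using b * \<open>M \<le> M'\<close> by (simp add: power_divide)
  moreover have "rate N * (star N N)\<^sup>2 = (h\<^sup>2 + r) / h\<^sup>2 * ((M - 2 * r) / M)\<^sup>2"
    unfolding *(5) by (simp add: rate_def h_def r_def power_divide power_mult_distrib)
  moreover have "(h\<^sup>2 + r) / h\<^sup>2 * ((M - 2 * r) / M)\<^sup>2 \<le> (h\<^sup>2 + r) / h\<^sup>2 * ((M' - 2 * r) / M')\<^sup>2"
    using calculation(1) b by (intro mult_left_mono) auto
  ultimately show ?thesis by linarith
qed

text \<open>
  The same argument as before, with a sharper bound for \<open>M\<close>. The right-hand side is \<open>2 / \<theta> N\<close> to leading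
  order; the summand \<open>6\<close> is the largest one for which \<open>coupling_schur_nonneg\<close> can be derived from this.
\<close>

lemma rate_star_last_le:
  assumes "N \<ge> 2"
  shows "2 / (\<theta> N + 6) \<le> 1 - rate N * (star N N)\<^sup>2"
proof -
  obtain n where N: "N = Suc n" using assms by (cases N) auto
  define h r where "h = \<theta> N" and "r = \<theta>_mean N - 1"
  obtain w M where *: "M = h\<^sup>2 + h + r - w" "1/2 \<le> w" "0 < M" "0 < M - 2 * r" "star N N = (M - 2 * r) / (h * M)"
    by (rule last_multipliers[OF N, folded h_def r_def]) blast
  have b: "2/3 * h - 3/4 \<le> r" "r \<le> 2/3 * h - 2/3"
    using \<theta>_bounds[of n N] N by (simp_all add: h_def r_def)
  have h: "2 \<le> h" using \<theta>_mono[of 0 N] assms by (simp add: h_def)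
  define M' where "M' = h\<^sup>2 + h + r - 1/2"
  have "M \<le> M'" using * by (simp add: M'_def)
  then have "(M - 2 * r) / M \<le> (M' - 2 * r) / M'"
    using * b h by (simp add: field_simps)
  then have "((M - 2 * r) / M)\<^sup>2 \<le> ((M' - 2 * r) / M')\<^sup>2"
    using * by (intro power_mono) auto
  moreover have "(h\<^sup>2 + r) * (M' - 2 * r)\<^sup>2 * (h + 6) \<le> h\<^sup>2 * (h + 4) * M'\<^sup>2"
    using b h by (intro degree_polynomial_bound) (auto simp: M'_def)
  then have "(h\<^sup>2 + r) / h\<^sup>2 * ((M' - 2 * r) / M')\<^sup>2 \<le> (h + 4) / (h + 6)"
    using h * \<open>M \<le> M'\<close> by (simp add: power_divide divide_simps) (simp add: mult_ac)
  moreover have "rate N * (star N N)\<^sup>2 = (h\<^sup>2 + r) / h\<^sup>2 * ((M - 2 * r) / M)\<^sup>2"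
    unfolding *(5) by (simp add: rate_def h_def r_def power_divide power_mult_distrib)
  moreover have "(h\<^sup>2 + r) / h\<^sup>2 * ((M - 2 * r) / M)\<^sup>2 \<le> (h\<^sup>2 + r) / h\<^sup>2 * ((M' - 2 * r) / M')\<^sup>2"
    using calculation(1) b h by (intro mult_left_mono) auto
  ultimately have "rate N * (star N N)\<^sup>2 \<le> (h + 4) / (h + 6)" by linarith
  also have "\<dots> = 1 - 2 / (h + 6)" using h by (simp add: field_simps)
  finally show ?thesis by (simp add: h_def)
qed

lemma drift_nonneg: "0 \<le> drift i"
  using \<theta>_ge_1[of i] by (simp add: drift_def)

text \<open>
  The density decreases from \<open>N - 1\<close> to \<open>N\<close>, so this step contributes negatively to the couplings with the
  last gradient. The negative contribution is at most about twice the positive one.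
\<close>

lemma drift_last_le:
  assumes "i < N"
  shows "drift i * (chain_density N (N - 1) - chain_density N N)
    \<le> (2 - 2 / \<theta> N) * ((rate N * star N i - \<theta> i) * star N N)"
proof -
  obtain n where N: "N = Suc n" using assms by (cases N) auto
  define h t u r where "h = \<theta> N" and "t = \<theta> i" and "u = \<theta>_mean i" and "r = \<theta>_mean N - 1"
  define D E where "D = 2 * h\<^sup>2 - t\<^sup>2 - u + 2 * r" and "E = 2 * h\<^sup>2 * u - r * (t\<^sup>2 - u)"
  obtain w M where *: "M = h\<^sup>2 + h + r - w" "(h - 1) * w = r" "1/2 \<le> w" "w \<le> 2/3" "0 < M"
      "M - 2 * r = h * (h + 1 - w)" "chain_density N n = (M + 2 * w) / (M * h\<^sup>2)" "star N N = (M - 2 * r) / (h * M)"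
    by (rule last_multipliers[OF N, folded h_def r_def]) blast
  have b: "1 \<le> t" "t + 1/2 \<le> h" "2/3 * t \<le> u" "0 < D" "0 \<le> r" "r \<le> 2/3 * (h - 1)"
    using \<theta>_bounds[OF assms] by (simp_all add: h_def t_def u_def r_def D_def)
  have star_N: "star N N = (h + 1 - w) / M" using * b by simp
  have eps: "chain_density N (N - 1) - chain_density N N = 2 * w / (M * h\<^sup>2)"
  proof -
    have "chain_density N (N - 1) = (M + 2 * w) / (M * h\<^sup>2)" using *(7) by (simp add: N)
    moreover have "chain_density N N = 1 / h\<^sup>2" by (simp add: chain_density_last h_def)
    moreover have "0 < h" using b by simp
    ultimately show ?thesis using \<open>0 < M\<close> by (simp add: field_simps)
  qed
  have E: "2/3 * t * (2 * h\<^sup>2 - (h - 1) * (t - 2/3)) \<le> E"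
    using rate_excess_numerator[OF assms] by (simp add: h_def t_def u_def r_def E_def)
  have D: "D \<le> 2 * h\<^sup>2 - t\<^sup>2 - 2/3 * t + 4/3 * (h - 1)"
    unfolding D_def using b(3,6) by argo
  have "D * w \<le> (2 * h\<^sup>2 - t\<^sup>2 - 2/3 * t + 4/3 * (h - 1)) * (2/3)"
    using D b * by (intro mult_mono) auto
  then have "(t - 1) * h * (D * w)
      \<le> (t - 1) * h * ((2 * h\<^sup>2 - t\<^sup>2 - 2/3 * t + 4/3 * (h - 1)) * (2/3))"
    using b by (intro mult_left_mono) auto
  then have "(t - 1) * h * D * w \<le> (t - 1) * h * (2 * h\<^sup>2 - t\<^sup>2 - 2/3 * t + 4/3 * (h - 1)) * (2/3)"
    by (simp only: mult.assoc)
  also have "\<dots> \<le> (h - 1) * (h + 1/3) * (2 * h\<^sup>2 - (h - 1) * (t - 2/3)) * (2/3)"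
    using b by (intro mult_right_mono drift_polynomial_bound) auto
  finally have "t * ((t - 1) * h * D * w) \<le> t * ((h - 1) * (h + 1/3) * (2 * h\<^sup>2 - (h - 1) * (t - 2/3)) * (2/3))"
    using b by (intro mult_left_mono) auto
  also have "\<dots> = (h - 1) * (h + 1/3) * (2/3 * t * (2 * h\<^sup>2 - (h - 1) * (t - 2/3)))" by simp
  also have "\<dots> \<le> (h - 1) * (h + 1/3) * E" using E b by (intro mult_left_mono) auto
  finally have le: "t * ((t - 1) * h * D * w) \<le> (h - 1) * (h + 1/3) * E" .
  moreover have "0 \<le> t * ((t - 1) * h * D * w)" using b * by (intro mult_nonneg_nonneg) auto
  moreover have "0 < (h - 1) * (h + 1/3)" using b by (intro mult_pos_pos) auto
  ultimately have "0 \<le> E" by (smt (verit) zero_le_mult_iff)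
  then have "(h - 1) * (h + 1/3) * E \<le> (h - 1) * (h + 1 - w) * E"
    using b * by (intro mult_right_mono mult_left_mono) auto
  with le have main: "t * ((t - 1) * h * D * w) \<le> (h - 1) * (h + 1 - w) * E" by (rule order_trans)
  have "t\<^sup>2 * (t - 1) * (2 * w / (M * h\<^sup>2)) = 2 * t / (M * h^3 * D) * (t * ((t - 1) * h * D * w))"
    using b * by (simp add: power2_eq_square power3_eq_cube)
  also have "\<dots> \<le> 2 * t / (M * h^3 * D) * ((h - 1) * (h + 1 - w) * E)"
    using b * by (intro mult_left_mono main divide_nonneg_nonneg mult_nonneg_nonneg) auto
  also have "\<dots> = (2 - 2 / h) * ((E / (h\<^sup>2 * D) * t) * star N N)"
    using b * unfolding star_N by (simp add: power2_eq_square power3_eq_cube divide_simps)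
  also have "\<dots> \<le> (2 - 2 / h) * ((rate N * star N i - t) * star N N)"
  proof (intro mult_left_mono mult_right_mono)
    have "E / (h\<^sup>2 * D) * t = rate N * (t * chain_density N i) - t"
      using rate_excess[OF assms] by (simp add: h_def t_def u_def r_def E_def D_def algebra_simps)
    also have "\<dots> \<le> rate N * star N i - t"
      using star_ge[OF assms] rate_pos[of N] by (simp add: t_def)
    finally show "E / (h\<^sup>2 * D) * t \<le> rate N * star N i - t" .
  qed (use star_pos[of N N] b in \<open>auto simp: field_simps\<close>)
  finally show ?thesis unfolding eps by (simp add: drift_def h_def t_def)
qed

text \<open>
  Multiplying \<open>chain_balance\<close> out, \<open>star N k\<close> becomes a function of the previous density \<open>c\<close> that
  increases with \<open>c\<close>. By monotonicity \<open>c\<close> is at most the density at \<open>N - 1\<close>, which exceeds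
  \<open>1 / (\<theta> N)\<^sup>2\<close> by a relative error of at most \<open>4 / (3 * (\<theta> N)\<^sup>2)\<close>.
\<close>

lemma rate_star_le:
  assumes "0 < k" "k < N"
  shows "rate N * star N k \<le> (1 + 3 / (2 * \<theta> N)) * \<theta> k"
proof -
  obtain n where N: "N = Suc n" using assms by (cases N) auto
  obtain j where k: "k = Suc j" using assms by (cases k) auto
  define h t u r where "h = \<theta> N" and "t = \<theta> k" and "u = \<theta>_mean k" and "r = \<theta>_mean N - 1"
  define D v c c' where "D = 2 * h\<^sup>2 - t\<^sup>2 - u + 2 * r" and "v = \<theta>_mean j" and "c = chain_density N j" and "c' = chain_density N k"
  obtain w M where *: "M = h\<^sup>2 + h + r - w" "1/2 \<le> w" "w \<le> 2/3" "0 < M"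
      "chain_density N n = (M + 2 * w) / (M * h\<^sup>2)"
    by (rule last_multipliers[OF N, folded h_def r_def]) blast
  have b: "1 \<le> t" "t + 1/2 \<le> h" "2/3 * t + 1/4 \<le> u" "u \<le> 2/3 * t + 1/3" "0 < D"
    "2/3 * h - 3/4 \<le> r" "r \<le> 2/3 * h - 2/3"
    using \<theta>_bounds[OF assms(2)] by (simp_all add: h_def t_def u_def r_def D_def)
  have "1 * t \<le> t * t" using b by (intro mult_right_mono) auto
  then have tu: "0 \<le> t\<^sup>2 - u" using b unfolding power2_eq_square by linarith
  have c: "h\<^sup>2 * c \<le> 1 + 4 / (3 * h\<^sup>2)"
  proof -
    have "h\<^sup>2 \<le> M" using * b by simp
    have "c \<le> chain_density N n" unfolding c_def using assms by (intro chain_density_mono) (auto simp: N k)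
    then have "h\<^sup>2 * c \<le> h\<^sup>2 * chain_density N n" by (intro mult_left_mono) auto
    also have "\<dots> = 1 + 2 * w / M" using * b by (simp add: field_simps)
    also have "2 * w / M \<le> (4/3) / h\<^sup>2" using * b \<open>h\<^sup>2 \<le> M\<close> by (intro frac_le) auto
    finally show ?thesis by simp
  qed
  have prev: "(\<theta> j)\<^sup>2 = t\<^sup>2 - t" using \<theta>_square_Suc[of j] by (simp add: t_def k)
  have uv: "(t - 1) * v = t * (u - 1)"
    using b by (simp add: u_def k \<theta>_mean.simps(2) v_def t_def field_simps)
  have c'D: "h\<^sup>2 * c' * D = 2 * h\<^sup>2 - t\<^sup>2 + u"
    using b unfolding c'_def chain_density_less[OF assms(2)] by (simp add: D_def h_def t_def u_def r_def)
  define D' where "D' = D + t + u - v"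
  have D': "D' = 2 * h\<^sup>2 - (\<theta> j)\<^sup>2 - v + 2 * r" by (simp add: D'_def D_def prev)
  have "D' > 0" unfolding D' using \<theta>_bounds(7)[of j N] assms by (simp add: k v_def h_def r_def)
  then have cD: "h\<^sup>2 * c * D' = 2 * h\<^sup>2 - (t\<^sup>2 - t) + v"
    using b assms chain_density_less[of j N] unfolding D' c_def
    by (simp add: k h_def r_def v_def flip: prev)
  have star: "star N k = t * (t * c' - (t - 1) * c)"
    by (simp add: star_def k c_def c'_def prev) (simp add: t_def k algebra_simps power2_eq_square)
  have "h\<^sup>2 * (t * c' - (t - 1) * c) * D
      = t * (h\<^sup>2 * c' * D) - (t - 1) * (h\<^sup>2 * c * D') + h\<^sup>2 * c * ((t - 1) * t + (t - 1) * u - (t - 1) * v)"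
    unfolding D'_def by (simp add: algebra_simps)
  also have "\<dots> = 2 * h\<^sup>2 - 2 * t\<^sup>2 + 2 * t + h\<^sup>2 * c * (t\<^sup>2 - u)"
  proof -
    have "(t - 1) * (2 * h\<^sup>2 - (t\<^sup>2 - t) + v) = (t - 1) * (2 * h\<^sup>2 - (t\<^sup>2 - t)) + t * (u - 1)"
      unfolding distrib_left uv ..
    then show ?thesis unfolding cD c'D uv by (simp add: algebra_simps power2_eq_square)
  qed
  also have "\<dots> \<le> 2 * h\<^sup>2 - 2 * t\<^sup>2 + 2 * t + (1 + 4 / (3 * h\<^sup>2)) * (t\<^sup>2 - u)"
    using c tu by (intro add_left_mono mult_right_mono) auto
  also have "\<dots> = 2 * h\<^sup>2 - t\<^sup>2 + 2 * t - u + 4/3 * (t\<^sup>2 - u) / h\<^sup>2"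
    by (simp add: algebra_simps)
  finally have "(h\<^sup>2 + r) * (h\<^sup>2 * (t * c' - (t - 1) * c) * D)
      \<le> (h\<^sup>2 + r) * (2 * h\<^sup>2 - t\<^sup>2 + 2 * t - u + 4/3 * (t\<^sup>2 - u) / h\<^sup>2)"
    using b by (intro mult_left_mono) auto
  also have "\<dots> \<le> (h\<^sup>2 + 3/2 * h) * D"
    unfolding D_def using b by (intro star_polynomial_bound) auto
  finally have "((h\<^sup>2 + r) * (t * c' - (t - 1) * c) * h\<^sup>2) * D \<le> ((1 + 3 / (2 * h)) * h\<^sup>2) * D"
    using b by (simp add: algebra_simps power2_eq_square)
  then have "(h\<^sup>2 + r) * (t * c' - (t - 1) * c) * h\<^sup>2 \<le> (1 + 3 / (2 * h)) * h\<^sup>2"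
    using b(5) by (simp only: mult_le_cancel_right_pos)
  then have "(h\<^sup>2 + r) * (t * c' - (t - 1) * c) \<le> 1 + 3 / (2 * h)"
    using b by (simp add: mult_le_cancel_right_pos)
  then have "t * ((h\<^sup>2 + r) * (t * c' - (t - 1) * c)) \<le> t * (1 + 3 / (2 * h))"
    using b by (intro mult_left_mono) auto
  moreover have "rate N = h\<^sup>2 + r" by (simp add: rate_def h_def r_def)
  ultimately show ?thesis unfolding star by (simp add: h_def[symmetric] t_def[symmetric] mult_ac)
qed

text \<open>
  The product of two numbers is most negative when one is as large and the other as small as allowed.
\<close>

lemma product_ge_neg:
  fixes x y X Y \<kappa> :: real
  assumes "- \<kappa> * X \<le> x" "x \<le> X" "- \<kappa> * Y \<le> y" "y \<le> Y" "0 \<le> \<kappa>" "\<kappa> \<le> 1" "0 \<le> X" "0 \<le> Y"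
  shows "- (\<kappa> * X * Y) \<le> x * y"
proof (cases "0 \<le> x")
  case True
  have "- (\<kappa> * X * Y) \<le> - (\<kappa> * x * Y)"
    using assms by (simp add: mult_left_mono mult_right_mono)
  also have "\<dots> \<le> x * y" using True mult_left_mono[OF assms(3) True] by (simp add: mult_ac)
  finally show ?thesis .
next
  case False
  have "- (\<kappa> * X) * Y \<le> x * Y" using assms by (intro mult_right_mono) auto
  also have "x * Y \<le> x * y" using assms False by (intro mult_left_mono_neg) auto
  finally show ?thesis by simp
qed

text \<open>
  Put \<open>e j = rate N * star N j - \<theta> j\<close>, which is nonnegative. Since the density increases before \<open>N\<close>,
  \<open>coupling N i k \<ge> e i * star N k\<close>. The coupling of \<open>j\<close> with the last gradient lies between
  \<open>- \<kappa> * (e j * star N N)\<close> and \<open>e j * star N N\<close>, where \<open>\<kappa> = 1 - 2 / \<theta> N\<close>, by \<open>drift_last_le\<close>. Hence the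
  product of two of them is at least \<open>- \<kappa> * (e i * star N N) * (e k * star N N)\<close>, and the claim reduces
  to \<open>\<kappa> * e k * (star N N)\<^sup>2 \<le> d * star N k\<close>. With the bounds on \<open>e k\<close> and on \<open>d\<close> this is
  \<open>3 * (h - 2) * (h + 6) \<le> 4 * h\<^sup>2\<close>, that is, \<open>0 \<le> (h - 6)\<^sup>2\<close>.
\<close>

lemma coupling_schur_nonneg:
  assumes "i < k" "k < N"
  shows "0 \<le> (\<Sum>i<N. coupling N i N) * coupling N i k + coupling N i N * coupling N k N"
proof -
  define h d where "h = \<theta> N" and "d = (\<Sum>i<N. coupling N i N)"
  define e where "e = (\<lambda>i. rate N * star N i - \<theta> i)"
  define \<kappa> where "\<kappa> = 1 - 2 / h"
  have h: "2 \<le> h" using \<theta>_mono[of 0 N] assms by (simp add: h_def)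
  have \<kappa>: "0 \<le> \<kappa>" "\<kappa> \<le> 1" using h by (simp_all add: \<kappa>_def)
  have d: "d = 1 - rate N * (star N N)\<^sup>2" by (simp add: d_def coupling_last_sum)
  have d_ge: "2 / (h + 6) \<le> d" unfolding d h_def using assms by (intro rate_star_last_le) simp
  then have "0 < d" using h by (smt (verit) divide_pos_pos)
  have e_nonneg: "0 \<le> e j" if "j < N" for j
  proof -
    have "\<theta> j * 1 \<le> \<theta> j * (rate N * chain_density N j)" using rate_density_ge_1[OF that] by (intro mult_left_mono) (auto intro: less_imp_le)
    also have "\<dots> \<le> rate N * star N j" using star_ge[OF that] rate_pos[of N] by (simp add: mult.left_commute)
    finally show ?thesis by (simp add: e_def)
  qed
  have last: "- \<kappa> * (e j * star N N) \<le> coupling N j N \<and> coupling N j N \<le> e j * star N N" if j: "j < N" for j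
  proof -
    have "drift j * (chain_density N (N - 1) - chain_density N N) \<le> (1 + \<kappa>) * (e j * star N N)"
      using drift_last_le[OF j] by (simp add: \<kappa>_def h_def e_def)
    moreover have "0 \<le> drift j * (chain_density N (N - 1) - chain_density N N)"
    proof -
      obtain n where N: "N = Suc n" using j by (cases N) auto
      obtain w M where "1/2 \<le> w" "0 < M" "chain_density N n = (M + 2 * w) / (M * (\<theta> N)\<^sup>2)"
        by (rule last_multipliers[OF N]) blast
      moreover have "M / (M * (\<theta> N)\<^sup>2) \<le> (M + 2 * w) / (M * (\<theta> N)\<^sup>2)"
        using calculation by (intro divide_right_mono) auto
      ultimately have "chain_density N N \<le> chain_density N (N - 1)" by (simp add: chain_density_last N)
      then show ?thesis using drift_nonneg[of j] by simp
    qed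
    moreover have "coupling N j N = e j * star N N - drift j * (chain_density N (N - 1) - chain_density N N)"
      by (simp add: coupling_def e_def algebra_simps)
    ultimately show ?thesis by (simp add: algebra_simps)
  qed
  have i: "i < N" using assms by simp
  have "- (\<kappa> * (e i * star N N) * (e k * star N N)) \<le> coupling N i N * coupling N k N"
    using last[OF i] last[OF assms(2)] \<kappa> e_nonneg[OF i] e_nonneg[OF assms(2)] star_pos[of N N]
    by (intro product_ge_neg) auto
  moreover have "\<kappa> * (e i * star N N) * (e k * star N N) \<le> d * (e i * star N k)"
  proof -
    have "e k \<le> 3 / (2 * h) * \<theta> k"
      using rate_star_le[of k N] assms by (simp add: e_def h_def algebra_simps)
    then have "\<kappa> * e k \<le> \<kappa> * (3 / (2 * h) * \<theta> k)" using \<kappa> by (intro mult_left_mono)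
    also have "\<dots> \<le> 2 / (h + 6) * \<theta> k"
    proof -
      have "h * 12 \<le> h * h + 36"
        using zero_le_power2[of "h - 6"] by (simp add: power2_eq_square algebra_simps)
      then have "\<kappa> * (3 / (2 * h)) \<le> 2 / (h + 6)"
        using h unfolding \<kappa>_def by (simp add: divide_simps) (simp add: power2_eq_square algebra_simps)
      then have "\<kappa> * (3 / (2 * h)) * \<theta> k \<le> 2 / (h + 6) * \<theta> k" by (intro mult_right_mono) (auto intro: less_imp_le)
      then show ?thesis by (simp add: mult_ac)
    qed
    also have "\<dots> \<le> d * \<theta> k" using d_ge by (intro mult_right_mono) (auto intro: less_imp_le)
    also have "\<dots> \<le> d * (rate N * star N k)"
      using e_nonneg[OF assms(2)] \<open>0 < d\<close> by (intro mult_left_mono) (auto simp: e_def)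
    finally have "(\<kappa> * e k) * (star N N)\<^sup>2 \<le> d * (rate N * star N k) * (star N N)\<^sup>2"
      by (intro mult_right_mono) auto
    also have "\<dots> = (d * star N k) * (rate N * (star N N)\<^sup>2)" by simp
    also have "\<dots> \<le> (d * star N k) * 1"
      using \<open>0 < d\<close> star_pos[of k N] assms d by (intro mult_left_mono) auto
    finally have "e i * ((\<kappa> * e k) * (star N N)\<^sup>2) \<le> e i * (d * star N k)"
      using e_nonneg[OF i] by (intro mult_left_mono) auto
    then show ?thesis by (simp add: power2_eq_square mult_ac)
  qed
  moreover have "d * (e i * star N k) \<le> d * coupling N i k"
  proof -
    have "chain_density N (k - 1) \<le> chain_density N k" using assms by (intro chain_density_mono) auto
    then have "0 \<le> drift i * (chain_density N k - chain_density N (k - 1))" using drift_nonneg[of i] by simp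
    then have "e i * star N k \<le> coupling N i k" by (simp add: coupling_def e_def algebra_simps)
    then show ?thesis using \<open>0 < d\<close> by simp
  qed
  ultimately show ?thesis unfolding d_def[symmetric] by linarith
qed

section \<open>The convergence rate\<close>

text \<open>
  The case \<open>L = 1\<close>, for abstract sequences of points, gradients and function values.
\<close>

lemma normalized_bound:
  fixes x G :: "nat \<Rightarrow> 'a::real_inner"
  assumes "N \<ge> 1"
    and x: "\<And>k. k \<le> N \<Longrightarrow> x k = x 0 - (\<Sum>i<k. \<theta> i *\<^sub>R G i) + (1 / (\<theta> k)\<^sup>2) *\<^sub>R (\<Sum>i<k. drift i *\<^sub>R G i)"
    and interp: "\<And>k. F (Suc k) + inner (G (Suc k)) (x k - x (Suc k)) + (norm (G k - G (Suc k)))\<^sup>2 / 2 \<le> F k"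
    and interp_min: "\<And>k. F k + inner (G k) (x_min - x k) + (norm (G k))\<^sup>2 / 2 \<le> F_min"
  shows "F N - F_min \<le> (norm (x 0 - x_min))\<^sup>2 / (2 * rate N)"
proof -
  define R E S where "R = rate N" and "E = x 0 - x_min" and "S = (\<Sum>k<Suc N. star N k *\<^sub>R G k)"
  have R: "R > 0" using rate_pos by (simp add: R_def)
  define diag cross where "diag = (\<Sum>k<Suc N. (if k < N then 2 * chain N (Suc k) else 1) * (norm (G k))\<^sup>2)"
    and "cross = (\<Sum>k<Suc N. \<Sum>i<k. (\<theta> i * star N k - drift i * (chain_density N k - chain_density N (k - 1))) * inner (G i) (G k))"
  have "chain N (Suc N) * (F N - F_min)
    \<le> inner (x 0 - x_min) (\<Sum>k\<le>N. star N k *\<^sub>R G k)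
      - (\<Sum>k<N. chain N (Suc k) * (norm (G k))\<^sup>2) - chain N (Suc N) / 2 * (norm (G N))\<^sup>2
      - (\<Sum>k\<le>N. \<Sum>i<k. (\<theta> i * star N k - drift i * (chain_density N k - chain_density N (k - 1))) * inner (G i) (G k))"
    by (rule weighted_interpolation_sum[OF _ _ x interp interp_min])
      (auto intro: chain_nonneg less_imp_le[OF star_pos])
  moreover have "diag = 2 * (\<Sum>k<N. chain N (Suc k) * (norm (G k))\<^sup>2) + (norm (G N))\<^sup>2"
    by (simp add: diag_def sum_distrib_left mult.assoc del: chain_simps)
  ultimately have upper: "F N - F_min \<le> inner E S - diag / 2 - cross"
    unfolding chain_final E_def S_def cross_def lessThan_Suc_atMost[symmetric] by argo
  have square: "inner E S \<le> (norm E)\<^sup>2 / (2 * R) + R / 2 * (norm S)\<^sup>2"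
  proof -
    have "0 \<le> (norm (E - R *\<^sub>R S))\<^sup>2 / (2 * R)" using R by simp
    also have "\<dots> = (norm E)\<^sup>2 / (2 * R) + R / 2 * (norm S)\<^sup>2 - inner E S"
      using R unfolding norm_square_diff by (simp add: power_mult_distrib power2_eq_square field_simps)
    finally show ?thesis by simp
  qed
  have "(\<Sum>k<Suc N. \<Sum>i<k. coupling N i k * (norm (G i - G k))\<^sup>2)
      = (\<Sum>k<Suc N. ((if k < N then 2 * chain N (Suc k) else 1) - R * (star N k)\<^sup>2) * (norm (G k))\<^sup>2)
        - 2 * (\<Sum>k<Suc N. \<Sum>i<k. coupling N i k * inner (G i) (G k))"
    unfolding sum_weighted_distances R_def
    by (intro arg_cong2[of _ _ _ _ minus] sum.cong refl) (simp only: coupling_row_sum less_Suc_eq_le lessThan_iff)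
  also have "(\<Sum>k<Suc N. ((if k < N then 2 * chain N (Suc k) else 1) - R * (star N k)\<^sup>2) * (norm (G k))\<^sup>2)
      = diag - R * (\<Sum>k<Suc N. (star N k)\<^sup>2 * (norm (G k))\<^sup>2)"
    unfolding diag_def sum_distrib_left sum_subtractf[symmetric]
    by (intro sum.cong refl) (simp add: left_diff_distrib mult.assoc)
  also have "(\<Sum>k<Suc N. \<Sum>i<k. coupling N i k * inner (G i) (G k))
      = R * (\<Sum>k<Suc N. \<Sum>i<k. star N i * star N k * inner (G i) (G k)) - cross"
    unfolding cross_def sum_distrib_left sum_subtractf[symmetric]
    by (intro sum.cong refl) (simp add: coupling_def R_def algebra_simps)
  finally have "(\<Sum>k<Suc N. \<Sum>i<k. coupling N i k * (norm (G i - G k))\<^sup>2) = diag + 2 * cross - R * (norm S)\<^sup>2"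
    unfolding S_def norm_square_linear_combination by argo
  moreover have "0 \<le> (\<Sum>k<Suc N. \<Sum>i<k. coupling N i k * (norm (G i - G k))\<^sup>2)"
    using coupling_schur_nonneg rate_star_last_less_1[OF \<open>N \<ge> 1\<close>]
    by (intro Laplacian_nonneg_by_elimination) (auto simp: coupling_last_sum)
  ultimately have "0 \<le> diag + 2 * cross - R * (norm S)\<^sup>2" by simp
  then have "inner E S - diag / 2 - cross \<le> (norm E)\<^sup>2 / (2 * R)" using square by argo
  then show ?thesis using upper by (simp add: E_def R_def)
qed

text \<open>
  Averaging multiplies the distance of \<open>y (k + 1)\<close> from \<open>z (k + 1)\<close> by \<open>1 - 1 / \<theta> (k + 1)\<close>, which is
  \<open>(\<theta> k)\<^sup>2 / (\<theta> (k + 1))\<^sup>2\<close>. So a step only adds one gradient to \<open>(\<theta> k)\<^sup>2 * (x k - z k)\<close>.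
\<close>

lemma FGM_closed_form:
  fixes x y z :: "nat \<Rightarrow> 'a::real_inner"
  assumes iter: "FGM_iterates N L f x y z" and "k \<le> N"
  defines "G \<equiv> \<lambda>k. (1 / L) *\<^sub>R gradient f (x k)"
  shows "z k = x 0 - (\<Sum>i<k. \<theta> i *\<^sub>R G i)"
    and "x k = z k + (1 / (\<theta> k)\<^sup>2) *\<^sub>R (\<Sum>i<k. drift i *\<^sub>R G i)"
proof -
  have "z k = x 0 - (\<Sum>i<k. \<theta> i *\<^sub>R G i) \<and> x k = z k + (1 / (\<theta> k)\<^sup>2) *\<^sub>R (\<Sum>i<k. drift i *\<^sub>R G i)"
    using \<open>k \<le> N\<close>
  proof (induction k)
    case 0 then show ?case using iter by (simp add: FGM_iterates_def)
  next
    case (Suc k)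
    define h W where "h = \<theta> (Suc k)" and "W = (\<Sum>i<k. drift i *\<^sub>R G i)"
    have y': "y (Suc k) = x k - G k" and z': "z (Suc k) = z k - \<theta> k *\<^sub>R G k"
      and x': "x (Suc k) = (1 - 1 / h) *\<^sub>R y (Suc k) + (1 / h) *\<^sub>R z (Suc k)"
      using iter Suc.prems by (simp_all add: FGM_iterates_def G_def h_def)
    have xk: "x k = z k + (1 / (\<theta> k)\<^sup>2) *\<^sub>R W" using Suc by (simp add: W_def)
    have "y (Suc k) - z (Suc k) = (1 / (\<theta> k)\<^sup>2) *\<^sub>R W + (\<theta> k - 1) *\<^sub>R G k"
      unfolding y' z' xk by (simp add: algebra_simps)
    also have "(\<theta> k - 1) *\<^sub>R G k = (1 / (\<theta> k)\<^sup>2) *\<^sub>R (drift k *\<^sub>R G k)"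
      by (simp add: drift_def)
    finally have yz: "y (Suc k) - z (Suc k) = (1 / (\<theta> k)\<^sup>2) *\<^sub>R (W + drift k *\<^sub>R G k)"
      by (simp add: scaleR_add_right)
    have "(1 - 1 / h) * (1 / (\<theta> k)\<^sup>2) = 1 / h\<^sup>2"
    proof -
      have "(\<theta> k)\<^sup>2 = (1 - 1 / h) * h\<^sup>2"
      proof -
        have "(1 - 1 / h) * h\<^sup>2 = h\<^sup>2 - h" by (simp add: h_def field_simps power2_eq_square)
        then show ?thesis using \<theta>_square_Suc[of k] by (simp add: h_def)
      qed
      then show ?thesis by (simp add: h_def field_simps)
    qed
    moreover have "x (Suc k) = z (Suc k) + (1 - 1 / h) *\<^sub>R (y (Suc k) - z (Suc k))"
      unfolding x' by (simp add: algebra_simps)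
    ultimately have "x (Suc k) = z (Suc k) + (1 / h\<^sup>2) *\<^sub>R (W + drift k *\<^sub>R G k)"
      unfolding yz by (simp only: scaleR_scaleR)
    then show ?case using Suc z' by (simp add: h_def W_def)
  qed
  then show "z k = x 0 - (\<Sum>i<k. \<theta> i *\<^sub>R G i)"
    and "x k = z k + (1 / (\<theta> k)\<^sup>2) *\<^sub>R (\<Sum>i<k. drift i *\<^sub>R G i)" by auto
qed

theorem theorem5p2:
  fixes f :: "'a::{real_inner, complete_space} \<Rightarrow> real"
    and L R :: real and N :: nat
    and xstar :: 'a and x y z :: "nat \<Rightarrow> 'a"
  assumes nonzero: "\<exists>v::'a. v \<noteq> 0"
    and "L > 0"
    and convex: "convex_on UNIV f"
    and differentiable: "\<And>u. f differentiable (at u)"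
    and smooth: "L_smooth L f"
    and minimizer: "\<And>u. f xstar \<le> f u"
    and "N \<ge> 1"
    and "R \<ge> 0"
    and start: "norm (x 0 - xstar) \<le> R"
    and iterates: "FGM_iterates N L f x y z"
  shows "f (x N) - f xstar
    \<le> (L * R\<^sup>2 * (\<theta> N)\<^sup>2) / (2 * (2 * (\<Sum>j=0..N. (\<theta> j) ^ 3) - (\<theta> N)\<^sup>2))"
proof -
  define G where "G = (\<lambda>k. (1 / L) *\<^sub>R gradient f (x k))"
  have grad: "GDERIV f u :> gradient f u" for u
    using differentiable by (rule GDERIV_gradient)
  have lip: "norm (gradient f u - gradient f w) \<le> L * norm (u - w)" for u w
    using smooth by (simp add: L_smooth_def)
  have interp: "f u / L + inner ((1 / L) *\<^sub>R gradient f u) (w - u)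
      + (norm ((1 / L) *\<^sub>R gradient f w - (1 / L) *\<^sub>R gradient f u))\<^sup>2 / 2 \<le> f w / L" for u w
  proof -
    have "(norm ((1 / L) *\<^sub>R gradient f w - (1 / L) *\<^sub>R gradient f u))\<^sup>2
        = (norm (gradient f w - gradient f u))\<^sup>2 / L\<^sup>2"
      by (simp add: power_divide flip: scaleR_diff_right)
    then show ?thesis
      using divide_right_mono[OF smooth_convex_interpolation[OF grad convex \<open>L > 0\<close> lip, of u w], of L] \<open>L > 0\<close>
      by (simp add: add_divide_distrib power2_eq_square)
  qed
  have min0: "gradient f xstar = 0"
    using gradient_zero_at_minimizer[OF grad minimizer] .
  have "f (x N) / L - f xstar / L \<le> (norm (x 0 - xstar))\<^sup>2 / (2 * rate N)"
  proof (rule normalized_bound[where G = G])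
    show "x k = x 0 - (\<Sum>i<k. \<theta> i *\<^sub>R G i) + (1 / (\<theta> k)\<^sup>2) *\<^sub>R (\<Sum>i<k. drift i *\<^sub>R G i)"
      if "k \<le> N" for k
      using FGM_closed_form[OF iterates that] by (simp add: G_def)
    show "f (x (Suc k)) / L + inner (G (Suc k)) (x k - x (Suc k)) + (norm (G k - G (Suc k)))\<^sup>2 / 2
        \<le> f (x k) / L" for k
      using interp[of "x (Suc k)" "x k"] by (simp only: G_def)
    show "f (x k) / L + inner (G k) (xstar - x k) + (norm (G k))\<^sup>2 / 2 \<le> f xstar / L" for k
      using interp[of "x k" xstar] by (simp add: G_def min0)
  qed fact
  also have "\<dots> \<le> R\<^sup>2 / (2 * rate N)"
    using start rate_pos[of N] by (intro divide_right_mono power_mono) auto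
  finally have "f (x N) - f xstar \<le> L * (R\<^sup>2 / (2 * rate N))"
    using \<open>L > 0\<close> by (simp add: field_simps)
  also have "\<dots> = (L * R\<^sup>2 * (\<theta> N)\<^sup>2) / (2 * ((\<theta> N)\<^sup>2 * rate N))"
    by simp
  also have "(\<theta> N)\<^sup>2 * rate N = 2 * (\<Sum>j=0..N. (\<theta> j) ^ 3) - (\<theta> N)\<^sup>2"
    unfolding atLeast0AtMost sum_\<theta>_cube rate_def
    by (simp add: algebra_simps power2_eq_square power4_eq_xxxx)
  finally show ?thesis .
qed

end
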